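(* Let $g \in L^2(\mathbb{R}^d)$, let $\Lambda \subseteq \mathbb{R}^d$ be a lattice and $S \in \mathrm{Sp}_{2d}(\mathbb{R})$. For a sequence $\{c_\lambda\}_{\lambda\in\Lambda}\subseteq\mathbb{C}$ put $f = \sum_{\lambda\in\Lambda} c_\lambda T_\lambda^S \mathcal{R}g$ and $f_\times = \sum_{\lambda\in\Lambda} \overline{c_\lambda} T_\lambda^S \mathcal{R}g$. Then: (1) If $\{ c_\lambda \} \in c_{00}(\Lambda)$, then $|V_gf(z)| = |V_g f_\times(z)|$ for all $z \in S(\mathbb{R}^d \times \Lambda^* )$. (2) If $\mathfrak{p}_{\Lambda^*}[\mu(S)^{-1}\mathcal{R}g] \in L^\infty(\mathcal{P}(\Lambda^* ))$ and $\{ c_\lambda \} \in \ell^2(\Lambda)$ (so that both series converge in $L^2(\mathbb{R}^d)$), then $|V_gf(z)| = |V_g f_\times(z)|$ for all $z \in S(\mathbb{R}^d \times \Lambda^* )$.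
   Context: $V_gf(x,\omega)=\int f(t)\overline{g(t-x)}e^{-2\pi i\omega\cdot t}dt$. $T_\lambda h(t)=h(t-\lambda)$, $\mathcal{R}h(t)=h(-t)$. $\mathrm{Sp}_{2d}(\mathbb{R})=\{S:S^T\mathcal{J}S=\mathcal{J}\}$, $\mathcal{J}=\begin{pmatrix}0&-I_d\\ I_d&0\end{pmatrix}$. $\mu(S)$ is the metaplectic operator associated to $S$ (unitary on $L^2(\mathbb{R}^d)$, determined up to sign), and $T_\lambda^S=\mu(S)T_\lambda\mu(S)^{-1}$. $c_{00}(\Lambda)$ is the set of sequences indexed by $\Lambda$ with finitely many nonzero entries. For $\Lambda=A\mathbb{Z}^d$: $\Lambda^*=A^{-T}\mathbb{Z}^d$, $\mathcal{P}(\Lambda^* )=A^{-T}[0,1]^d$; $\mathfrak{p}_\Gamma[\psi](t)=\sum_{\gamma\in\Gamma}|\mathcal{F}\psi(t+\gamma)|^2$ with $\mathcal{F}h(\omega)=\int h(t)e^{-2\pi i\omega\cdot t}dt$. $S(\mathbb{R}^d\times\Lambda^* )=\{S(x,\lambda):x\in\mathbb{R}^d,\lambda\in\Lambda^*\}$. *)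

theory Defs
  imports "HOL-Analysis.Analysis"
begin

type_synonym 'd rvec = "real ^ 'd"
type_synonym 'd sig = "'d rvec \<Rightarrow> complex"

section \<open>Square integrable functions on R^d (L^2 classes represented by functions)\<close>

definition L2 :: "'d::finite sig \<Rightarrow> bool" where
  "L2 f \<longleftrightarrow> f \<in> borel_measurable lborel \<and> integrable lborel (\<lambda>t. (cmod (f t))^2)"

definition l2dist :: "'d::finite sig \<Rightarrow> 'd sig \<Rightarrow> real" where
  "l2dist f h = sqrt (LINT t|lborel. (cmod (f t - h t))^2)"

definition L2_has_sum :: "('i \<Rightarrow> 'd::finite sig) \<Rightarrow> 'i set \<Rightarrow> 'd sig \<Rightarrow> bool" where
  "L2_has_sum F I f \<longleftrightarrow> L2 f \<and>
     (\<forall>e>0. \<exists>F0. finite F0 \<and> F0 \<subseteq> I \<and>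
        (\<forall>G. finite G \<and> F0 \<subseteq> G \<and> G \<subseteq> I \<longrightarrow> l2dist f (\<lambda>t. \<Sum>i\<in>G. F i t) < e))"

definition transl :: "'d::finite rvec \<Rightarrow> 'd sig \<Rightarrow> 'd sig" where
  "transl l h = (\<lambda>t. h (t - l))"

definition reflect :: "'d::finite sig \<Rightarrow> 'd sig" where
  "reflect h = (\<lambda>t. h (- t))"

definition pos :: "real ^ ('d::finite + 'd) \<Rightarrow> 'd rvec" where
  "pos z = (\<chi> k. z $ Inl k)"

definition freq :: "real ^ ('d::finite + 'd) \<Rightarrow> 'd rvec" where
  "freq z = (\<chi> k. z $ Inr k)"

definition pair_vec :: "'d::finite rvec \<Rightarrow> 'd rvec \<Rightarrow> real ^ ('d + 'd)" where
  "pair_vec x \<omega> = (\<chi> i. case i of Inl k \<Rightarrow> x $ k | Inr k \<Rightarrow> \<omega> $ k)"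

definition stft :: "'d::finite sig \<Rightarrow> 'd sig \<Rightarrow> real ^ ('d + 'd) \<Rightarrow> complex" where
  "stft g f z = (LINT t|lborel. f t * cnj (g (t - pos z))
                   * exp (- (2 * of_real pi * \<i> * of_real (freq z \<bullet> t))))"

definition tfshift :: "real ^ ('d::finite + 'd) \<Rightarrow> 'd sig \<Rightarrow> 'd sig" where
  "tfshift z h = (\<lambda>t. exp (- (of_real pi * \<i> * of_real (pos z \<bullet> freq z)))
                     * exp (2 * of_real pi * \<i> * of_real (freq z \<bullet> t)) * h (t - pos z))"

definition Jmat :: "real ^ ('d::finite + 'd) ^ ('d + 'd)" where
  "Jmat = (\<chi> i j. case (i, j) of
              (Inl a, Inr b) \<Rightarrow> (if a = b then -1 else 0)
            | (Inr a, Inl b) \<Rightarrow> (if a = b then 1 else 0)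
            | _ \<Rightarrow> 0)"

definition symplectic :: "real ^ ('d::finite + 'd) ^ ('d + 'd) \<Rightarrow> bool" where
  "symplectic S \<longleftrightarrow> transpose S ** Jmat ** S = Jmat"

definition unitary_pair :: "('d::finite sig \<Rightarrow> 'd sig) \<Rightarrow> ('d sig \<Rightarrow> 'd sig) \<Rightarrow> bool" where
  "unitary_pair U V \<longleftrightarrow>
     (\<forall>f. L2 f \<longrightarrow> L2 (U f) \<and> L2 (V f)) \<and>
     (\<forall>f h. L2 f \<longrightarrow> L2 h \<longrightarrow> (AE t in lborel. f t = h t) \<longrightarrow>
          (AE t in lborel. U f t = U h t) \<and> (AE t in lborel. V f t = V h t)) \<and>
     (\<forall>f h a. L2 f \<longrightarrow> L2 h \<longrightarrow>
          (AE t in lborel. U (\<lambda>s. f s + a * h s) t = U f t + a * U h t)) \<and>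
     (\<forall>f. L2 f \<longrightarrow> l2dist (U f) (\<lambda>_. 0) = l2dist f (\<lambda>_. 0)) \<and>
     (\<forall>f. L2 f \<longrightarrow> (AE t in lborel. V (U f) t = f t) \<and> (AE t in lborel. U (V f) t = f t))"

text \<open>U = mu(S) (up to a unimodular constant), V = mu(S)^{-1}: the unitary operators
  satisfying the symplectic covariance  mu(S) rho(z) mu(S)^{-1} = rho(S z).\<close>
definition metaplectic_pair ::
  "real ^ ('d::finite + 'd) ^ ('d + 'd) \<Rightarrow> ('d sig \<Rightarrow> 'd sig) \<Rightarrow> ('d sig \<Rightarrow> 'd sig) \<Rightarrow> bool" where
  "metaplectic_pair S U V \<longleftrightarrow> unitary_pair U V \<and>
     (\<forall>z f. L2 f \<longrightarrow> (AE t in lborel. U (tfshift z f) t = tfshift (S *v z) (U f) t))"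

definition transl_S :: "('d::finite sig \<Rightarrow> 'd sig) \<Rightarrow> ('d sig \<Rightarrow> 'd sig) \<Rightarrow> 'd rvec \<Rightarrow> 'd sig \<Rightarrow> 'd sig" where
  "transl_S U V l h = U (transl l (V h))"

definition int_vec :: "'d::finite rvec \<Rightarrow> bool" where
  "int_vec v \<longleftrightarrow> (\<forall>i. v $ i \<in> \<int>)"

definition lattice :: "real ^ 'd ^ 'd \<Rightarrow> 'd::finite rvec set" where
  "lattice A = {A *v v | v. int_vec v}"

definition dual_lattice :: "real ^ 'd ^ 'd \<Rightarrow> 'd::finite rvec set" where
  "dual_lattice A = {matrix_inv (transpose A) *v v | v. int_vec v}"

definition dual_cell :: "real ^ 'd ^ 'd \<Rightarrow> 'd::finite rvec set" where
  "dual_cell A = {matrix_inv (transpose A) *v v | v. \<forall>i. 0 \<le> v $ i \<and> v $ i \<le> 1}"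

definition fourier_trunc :: "real \<Rightarrow> 'd::finite sig \<Rightarrow> 'd sig" where
  "fourier_trunc R h = (\<lambda>\<omega>. LINT t|lborel. indicator {s. \<forall>i. \<bar>s $ i\<bar> \<le> R} t * h t
                              * exp (- (2 * of_real pi * \<i> * of_real (\<omega> \<bullet> t))))"

definition is_L2_fourier :: "'d::finite sig \<Rightarrow> 'd sig \<Rightarrow> bool" where
  "is_L2_fourier h H \<longleftrightarrow> L2 H \<and> ((\<lambda>R. l2dist H (fourier_trunc R h)) \<longlongrightarrow> 0) at_top"

text \<open>p_Gamma[psi](t) = sum_{gamma in Gamma} |F psi(t+gamma)|^2, with H = F psi.\<close>
definition periodization :: "'d::finite rvec set \<Rightarrow> 'd sig \<Rightarrow> 'd rvec \<Rightarrow> ennreal" where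
  "periodization \<Gamma> H t = (\<Sum>\<^sub>\<infinity>\<gamma>\<in>\<Gamma>. ennreal ((cmod (H (t + \<gamma>)))^2))"

end

theory Submission
  imports Defs "HOL-Probability.Characteristic_Functions"
begin

text \<open>
  By symplectic covariance \<open>T\<^sub>m\<^sup>S\<close> is the time-frequency shift \<open>\<rho>(S(m, 0))\<close>, and up to a phase that
  depends on \<open>z\<close> only, \<open>V\<^sub>gf(z)\<close> is the inner product of \<open>f\<close> with \<open>\<rho>(z)g\<close>. In the integral defining
  \<open>a\<^sub>m = \<langle>\<rho>(S(m, 0))\<R>g, \<rho>(z)g\<rangle>\<close> a reflection exchanges the two copies of \<open>g\<close>, so that
  \<open>a\<^sub>m = exp(2\<pi>i[S(m, 0), z]) cnj a\<^sub>m\<close> with the symplectic form in the exponent. For \<open>z = S(x, l)\<close> that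
  form equals \<open>-m \<bullet> l\<close>, an integer if \<open>l\<close> lies in the dual lattice. Hence every \<open>a\<^sub>m\<close> is real, and conjugating
  the coefficients conjugates \<open>\<Sum> c\<^sub>m a\<^sub>m\<close>.

  For square summable coefficients, convergence follows from a Bessel inequality for the translates of
  \<open>\<psi> = \<mu>(S)\<^sup>-\<^sup>1\<R>g\<close>: Plancherel's theorem turns \<open>\<Sum> c\<^sub>m T\<^sub>m \<psi>\<close> into the product of a trigonometric polynomial
  with \<open>\<F>\<psi>\<close>, and unfolding its energy over a fundamental domain of the dual lattice brings in the
  periodization of \<open>\<F>\<psi>\<close>.
\<close>

section \<open>Change of variables for Lebesgue measure\<close>

lemma lborel_integral_affine:
  fixes f :: "'a::euclidean_space \<Rightarrow> 'b::{banach, second_countable_topology}"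
  assumes [measurable]: "f \<in> borel_measurable borel" and c_nonzero: "c \<noteq> 0"
  shows "(LINT x|lborel. f x) = \<bar>c\<bar> ^ DIM('a) *\<^sub>R (LINT x|lborel. f (t + c *\<^sub>R x))"
  by (subst lborel_affine[OF c_nonzero, of t], subst integral_density) (auto simp: integral_distr)

lemma lborel_integrable_affine:
  fixes f :: "'a::euclidean_space \<Rightarrow> 'b::{banach, second_countable_topology}"
  assumes f_integrable: "integrable lborel f" and c_nonzero: "c \<noteq> 0"
  shows "integrable lborel (\<lambda>x. f (t + c *\<^sub>R x))"
proof -
  have [measurable]: "f \<in> borel_measurable borel" using f_integrable by auto
  have "integrable (density (distr lborel borel (\<lambda>x. t + c *\<^sub>R x)) (\<lambda>_. ennreal (\<bar>c\<bar>^DIM('a)))) f"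
    using f_integrable lborel_affine[OF c_nonzero, of t] by simp
  then have "integrable lborel (\<lambda>x. \<bar>c\<bar> ^ DIM('a) *\<^sub>R f (t + c *\<^sub>R x))"
    by (subst (asm) integrable_density) (auto simp: integrable_distr_eq)
  then have "integrable lborel (\<lambda>x. (1 / \<bar>c\<bar> ^ DIM('a)) *\<^sub>R (\<bar>c\<bar> ^ DIM('a) *\<^sub>R f (t + c *\<^sub>R x)))"
    by (rule integrable_scaleR_right)
  then show ?thesis
    using c_nonzero by simp
qed

lemma lborel_integral_reflect_shift:
  fixes f :: "'a::euclidean_space \<Rightarrow> 'b::{banach, second_countable_topology}"
  assumes "f \<in> borel_measurable borel"
  shows "(LINT x|lborel. f (a - x)) = (LINT x|lborel. f x)"
  using lborel_integral_affine[OF assms, of "-1" a] by simp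

lemma lborel_integral_shift:
  fixes f :: "'a::euclidean_space \<Rightarrow> 'b::{banach, second_countable_topology}"
  assumes "f \<in> borel_measurable borel"
  shows "(LINT x|lborel. f (x - a)) = (LINT x|lborel. f x)"
  using lborel_integral_affine[OF assms, of 1 "-a"] by simp

lemma nn_integral_lborel_shift:
  fixes f :: "'a::euclidean_space \<Rightarrow> ennreal"
  assumes [measurable]: "f \<in> borel_measurable borel"
  shows "(\<integral>\<^sup>+x. f (x + a) \<partial>lborel) = (\<integral>\<^sup>+x. f x \<partial>lborel)"
  by (subst (2) lborel_distr_plus[of a, symmetric]) (simp add: nn_integral_distr add.commute)

lemma AE_lborel_shift:
  fixes a :: "'a::euclidean_space"
  assumes "AE x in lborel. P x" and [measurable]: "Measurable.pred borel P"
  shows "AE x in lborel. P (x - a)"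
proof -
  have "AE x in distr lborel borel ((+) (- a)). P x"
    using assms(1) by (simp only: lborel_distr_plus)
  then show ?thesis
    by (subst (asm) AE_distr_iff) auto
qed

lemma integrable_lborel_tensor:
  fixes f :: "'a::euclidean_space \<Rightarrow> complex" and h :: "'b::euclidean_space \<Rightarrow> complex"
  assumes "integrable lborel f" "integrable lborel h"
  shows "integrable (lborel \<Otimes>\<^sub>M lborel) (\<lambda>(x, y). f x * h y)"
proof -
  have [measurable]: "f \<in> borel_measurable borel" "h \<in> borel_measurable borel"
    using assms by auto
  show ?thesis
    by (rule lborel_pair.Fubini_integrable) (use assms in \<open>auto simp: norm_mult\<close>)
qed

lemma
  fixes f :: "'a::euclidean_space \<Rightarrow> real \<Rightarrow> complex"
  assumes f_integrable: "\<And>b. integrable lborel (f b)"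
  shows integrable_lborel_prod_Basis:
      "integrable lborel (\<lambda>x::'a. \<Prod>b\<in>Basis. f b (x \<bullet> b))" (is "integrable lborel ?F")
    and lborel_integral_prod_Basis:
      "(LINT x|lborel. (\<Prod>b\<in>Basis. f b ((x::'a) \<bullet> b))) = (\<Prod>b\<in>Basis. LINT x|lborel. f b x)"
proof -
  interpret product_sigma_finite "\<lambda>_. lborel :: real measure" ..
  have [measurable]: "f b \<in> borel_measurable borel" for b
    using f_integrable by auto
  have F_borel: "?F \<in> borel_measurable borel"
    by measurable
  have coords: "?F (\<Sum>b\<in>Basis. y b *\<^sub>R b) = (\<Prod>b\<in>Basis. f b (y b))" for y
    by (intro prod.cong refl arg_cong[where f = "f _"]) (rule inner_sum_left_Basis)
  show "integrable lborel ?F"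
    by (subst lborel_eq, subst integrable_distr_eq)
      (use F_borel in \<open>auto simp: coords intro!: product_integrable_prod f_integrable\<close>)
  show "(LINT x|lborel. ?F x) = (\<Prod>b\<in>Basis. LINT x|lborel. f b x)"
    by (subst lborel_eq, subst integral_distr)
      (use F_borel in \<open>auto simp: coords intro!: product_integral_prod f_integrable\<close>)
qed

section \<open>Characters\<close>

definition cis2pi :: "real \<Rightarrow> complex" where
  "cis2pi r = cis (2 * pi * r)"

lemma cis2pi_0 [simp]: "cis2pi 0 = 1"
  by (simp add: cis2pi_def)

lemma norm_cis2pi [simp]: "cmod (cis2pi r) = 1"
  by (simp add: cis2pi_def)

lemma cis2pi_add: "cis2pi (a + b) = cis2pi a * cis2pi b"
  by (simp add: cis2pi_def cis_mult distrib_left)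

lemma cnj_cis2pi [simp]: "cnj (cis2pi r) = cis2pi (- r)"
  by (simp add: cis2pi_def cis_cnj)

lemma cis2pi_half: "cis2pi (1 / 2) = - 1"
  by (simp add: cis2pi_def)

lemma cis2pi_Ints: "r \<in> \<int> \<Longrightarrow> cis2pi r = 1"
  by (simp add: cis2pi_def cis_multiple_2pi)

lemma cis2pi_measurable [measurable]: "cis2pi \<in> borel_measurable borel"
  unfolding cis2pi_def[abs_def] by (intro borel_measurable_continuous_onI continuous_intros)

lemma exp_eq_cis2pi:
  "exp (2 * of_real pi * \<i> * of_real r) = cis2pi r"
  "exp (- (2 * of_real pi * \<i> * of_real r)) = cis2pi (- r)"
  "exp (- (of_real pi * \<i> * of_real r)) = cis2pi (- r / 2)"
  by (simp_all add: cis2pi_def cis_conv_exp mult_ac)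

lemma cnj_measurable [measurable]: "cnj \<in> borel_measurable borel"
  by (intro borel_measurable_continuous_onI continuous_intros)

section \<open>Square integrable functions\<close>

definition l2norm :: "'d::finite sig \<Rightarrow> real" where
  "l2norm f = sqrt (LINT t|lborel. (cmod (f t))\<^sup>2)"

definition l2inner :: "'d::finite sig \<Rightarrow> 'd sig \<Rightarrow> complex" where
  "l2inner f h = (LINT t|lborel. f t * cnj (h t))"

lemma l2dist_eq_l2norm: "l2dist f h = l2norm (\<lambda>t. f t - h t)"
  by (simp add: l2dist_def l2norm_def)

lemma l2norm_nonneg [simp]: "0 \<le> l2norm f"
  by (simp add: l2norm_def)

lemma l2norm_square: "(l2norm f)\<^sup>2 = (LINT t|lborel. (cmod (f t))\<^sup>2)"
  by (simp add: l2norm_def)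

lemma l2norm_cnj: "l2norm (\<lambda>t. cnj (f t)) = l2norm f"
  by (simp add: l2norm_def)

lemma l2norm_zero [simp]: "l2norm (\<lambda>t. 0) = 0"
  by (simp add: l2norm_def)

lemma l2norm_cmult: "l2norm (\<lambda>t. a * f t) = cmod a * l2norm f"
  by (simp add: l2norm_def norm_mult power_mult_distrib real_sqrt_mult)

lemma l2norm_diff_commute: "l2norm (\<lambda>t. f t - h t) = l2norm (\<lambda>t. h t - f t)"
  by (simp add: l2norm_def norm_minus_commute)

lemma l2inner_self: "l2inner f f = of_real ((l2norm f)\<^sup>2)"
  by (simp add: l2inner_def l2norm_square flip: complex_norm_square of_real_power)

lemma L2_measurable [measurable_dest]: "L2 f \<Longrightarrow> f \<in> borel_measurable borel"
  by (simp add: L2_def)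

lemma L2_iff_nn_integral:
  "L2 f \<longleftrightarrow> f \<in> borel_measurable borel \<and> (\<integral>\<^sup>+t. ennreal ((cmod (f t))\<^sup>2) \<partial>lborel) < \<infinity>"
  by (auto simp: L2_def integrable_iff_bounded)

lemma ennreal_l2norm_square:
  "L2 f \<Longrightarrow> ennreal ((l2norm f)\<^sup>2) = (\<integral>\<^sup>+t. ennreal ((cmod (f t))\<^sup>2) \<partial>lborel)"
  unfolding l2norm_square by (subst nn_integral_eq_integral) (auto simp: L2_def)

lemma
  assumes "f \<in> borel_measurable borel" "0 \<le> B"
    and energy_le: "(\<integral>\<^sup>+t. ennreal ((cmod (f t))\<^sup>2) \<partial>lborel) \<le> ennreal (B\<^sup>2)"
  shows L2_nn_integral_leI: "L2 f" and l2norm_nn_integral_leI: "l2norm f \<le> B"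
proof -
  show "L2 f"
    using assms by (simp add: L2_iff_nn_integral le_less_trans)
  then have "ennreal ((l2norm f)\<^sup>2) \<le> ennreal (B\<^sup>2)"
    using energy_le by (simp add: ennreal_l2norm_square)
  then show "l2norm f \<le> B"
    using \<open>0 \<le> B\<close> by (simp add: power2_le_iff_abs_le)
qed

lemma
  assumes L2_f: "L2 f" and [measurable]: "p \<in> borel_measurable borel" and p_le: "\<And>t. cmod (p t) \<le> K"
  shows L2_bounded_mult: "L2 (\<lambda>t. p t * f t)"
    and l2norm_bounded_mult_le: "l2norm (\<lambda>t. p t * f t) \<le> K * l2norm f"
proof -
  note [measurable] = L2_measurable[OF L2_f]
  have "0 \<le> K" by (rule order_trans[OF norm_ge_zero p_le[of 0]])
  then have "(cmod (p t * f t))\<^sup>2 \<le> K\<^sup>2 * (cmod (f t))\<^sup>2" for t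
    using p_le by (auto simp: norm_mult power_mult_distrib intro!: mult_right_mono power_mono)
  then have "(\<integral>\<^sup>+t. ennreal ((cmod (p t * f t))\<^sup>2) \<partial>lborel)
      \<le> (\<integral>\<^sup>+t. ennreal (K\<^sup>2) * ennreal ((cmod (f t))\<^sup>2) \<partial>lborel)"
    by (intro nn_integral_mono) (simp flip: ennreal_mult)
  also have "\<dots> = ennreal ((K * l2norm f)\<^sup>2)"
    using L2_f by (simp add: nn_integral_cmult ennreal_l2norm_square power_mult_distrib ennreal_mult)
  finally show "L2 (\<lambda>t. p t * f t)" "l2norm (\<lambda>t. p t * f t) \<le> K * l2norm f"
    using L2_nn_integral_leI[of "\<lambda>t. p t * f t" "K * l2norm f"]
      l2norm_nn_integral_leI[of "\<lambda>t. p t * f t" "K * l2norm f"] \<open>0 \<le> K\<close>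
    by auto
qed

lemma L2_zero [simp]: "L2 (\<lambda>t. 0)"
  by (simp add: L2_def)

lemma L2_cmult: "L2 f \<Longrightarrow> L2 (\<lambda>t. a * f t)"
  by (rule L2_bounded_mult[where K = "cmod a"]) auto

lemma L2_cnj: "L2 f \<Longrightarrow> L2 (\<lambda>t. cnj (f t))"
  using measurable_compose[OF _ cnj_measurable, of f lborel] by (simp add: L2_def)

lemma L2_mult_integrable:
  assumes "L2 f" "L2 h"
  shows "integrable lborel (\<lambda>t. f t * h t)"
proof (rule Bochner_Integration.integrable_bound)
  note [measurable] = assms[THEN L2_measurable]
  show "integrable lborel (\<lambda>t. (cmod (f t))\<^sup>2 + (cmod (h t))\<^sup>2)"
    using assms by (simp add: L2_def)
  have "cmod (f t) * cmod (h t) \<le> (cmod (f t))\<^sup>2 + (cmod (h t))\<^sup>2" for t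
  proof -
    have "0 \<le> cmod (f t) * cmod (h t)" by simp
    with sum_squares_bound[of "cmod (f t)" "cmod (h t)"] show ?thesis by linarith
  qed
  then show "AE t in lborel. norm (f t * h t) \<le> norm ((cmod (f t))\<^sup>2 + (cmod (h t))\<^sup>2)"
    by (auto simp: norm_mult)
  show "(\<lambda>t. f t * h t) \<in> borel_measurable lborel" by measurable
qed

lemma L2_l2inner_integrable:
  "L2 f \<Longrightarrow> L2 h \<Longrightarrow> integrable lborel (\<lambda>t. f t * cnj (h t))"
  by (intro L2_mult_integrable L2_cnj)

lemma integral_norm_mult_le_l2norm:
  assumes "L2 f" "L2 h"
  shows "(LINT t|lborel. cmod (f t * h t)) \<le> l2norm f * l2norm h"
proof (rule power2_le_imp_le)
  note [measurable] = assms[THEN L2_measurable]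
  have "ennreal ((LINT t|lborel. cmod (f t * h t))\<^sup>2)
      = (\<integral>\<^sup>+t. ennreal (cmod (f t)) * ennreal (cmod (h t)) \<partial>lborel)\<^sup>2"
    using integrable_norm[OF L2_mult_integrable[OF assms]]
    by (subst ennreal_power[symmetric], simp, subst nn_integral_eq_integral[symmetric])
       (auto simp: norm_mult ennreal_mult)
  also have "\<dots> \<le> (\<integral>\<^sup>+t. (ennreal (cmod (f t)))\<^sup>2 \<partial>lborel) * (\<integral>\<^sup>+t. (ennreal (cmod (h t)))\<^sup>2 \<partial>lborel)"
    by (rule Cauchy_Schwarz_nn_integral) measurable
  also have "\<dots> = ennreal ((l2norm f * l2norm h)\<^sup>2)"
    by (simp add: ennreal_power ennreal_l2norm_square[symmetric] assms power_mult_distrib ennreal_mult)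
  finally show "(LINT t|lborel. cmod (f t * h t))\<^sup>2 \<le> (l2norm f * l2norm h)\<^sup>2"
    by simp
qed simp

lemma norm_l2inner_le:
  assumes "L2 f" "L2 h"
  shows "cmod (l2inner f h) \<le> l2norm f * l2norm h"
proof -
  have "cmod (l2inner f h) \<le> (LINT t|lborel. cmod (f t * cnj (h t)))"
    unfolding l2inner_def by (rule integral_norm_bound)
  also have "\<dots> \<le> l2norm f * l2norm h"
    using integral_norm_mult_le_l2norm[OF assms(1) L2_cnj[OF assms(2)]] by (simp add: l2norm_cnj)
  finally show ?thesis .
qed

lemma
  assumes "L2 f" "L2 h"
  shows L2_add: "L2 (\<lambda>t. f t + h t)"
    and l2norm_triangle_ineq: "l2norm (\<lambda>t. f t + h t) \<le> l2norm f + l2norm h"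
proof -
  note [measurable] = assms[THEN L2_measurable]
  let ?q = "\<lambda>t. (cmod (f t))\<^sup>2 + 2 * cmod (f t * h t) + (cmod (h t))\<^sup>2"
  have q_integrable: "integrable lborel ?q"
    using L2_mult_integrable[OF assms] assms by (auto simp: L2_def)
  have "(\<integral>\<^sup>+t. ennreal ((cmod (f t + h t))\<^sup>2) \<partial>lborel) \<le> (\<integral>\<^sup>+t. ennreal (?q t) \<partial>lborel)"
  proof (intro nn_integral_mono ennreal_leI)
    fix t
    have "(cmod (f t + h t))\<^sup>2 \<le> (cmod (f t) + cmod (h t))\<^sup>2"
      by (intro power_mono norm_triangle_ineq) auto
    then show "(cmod (f t + h t))\<^sup>2 \<le> ?q t"
      by (simp add: power2_sum norm_mult)
  qed
  also have "\<dots> = ennreal (LINT t|lborel. ?q t)"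
    using q_integrable by (intro nn_integral_eq_integral) auto
  also have "(LINT t|lborel. ?q t) = (l2norm f)\<^sup>2 + 2 * (LINT t|lborel. cmod (f t * h t)) + (l2norm h)\<^sup>2"
    using L2_mult_integrable[OF assms] assms by (simp add: L2_def l2norm_square)
  also have "\<dots> \<le> (l2norm f + l2norm h)\<^sup>2"
    using integral_norm_mult_le_l2norm[OF assms] by (simp add: power2_sum)
  finally show "L2 (\<lambda>t. f t + h t)" "l2norm (\<lambda>t. f t + h t) \<le> l2norm f + l2norm h"
    using L2_nn_integral_leI[of "\<lambda>t. f t + h t" "l2norm f + l2norm h"]
      l2norm_nn_integral_leI[of "\<lambda>t. f t + h t" "l2norm f + l2norm h"]
    by (auto simp: ennreal_leI)
qed

lemma L2_diff: "L2 f \<Longrightarrow> L2 h \<Longrightarrow> L2 (\<lambda>t. f t - h t)"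
  using L2_add[OF _ L2_cmult, of f h "-1"] by simp

lemma L2_sum: "(\<And>i. i \<in> G \<Longrightarrow> L2 (F i)) \<Longrightarrow> L2 (\<lambda>t. \<Sum>i\<in>G. F i t)"
  by (induction G rule: infinite_finite_induct) (auto intro: L2_add)

lemma l2norm_diff_triangle:
  assumes "L2 f" "L2 h" "L2 k"
  shows "l2norm (\<lambda>t. f t - k t) \<le> l2norm (\<lambda>t. f t - h t) + l2norm (\<lambda>t. h t - k t)"
  using l2norm_triangle_ineq[OF L2_diff[OF assms(1,2)] L2_diff[OF assms(2,3)]] by simp

lemma l2norm_triangle_ineq3:
  assumes "L2 f" "L2 h"
  shows "\<bar>l2norm f - l2norm h\<bar> \<le> l2norm (\<lambda>t. f t - h t)"
  using l2norm_triangle_ineq[OF assms(2) L2_diff[OF assms]]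
    l2norm_triangle_ineq[OF assms(1) L2_diff[OF assms(2,1)]]
  by (simp add: l2norm_diff_commute[of h])

lemma l2norm_sum_le:
  assumes "\<And>i. i \<in> G \<Longrightarrow> L2 (F i)"
  shows "l2norm (\<lambda>t. \<Sum>i\<in>G. F i t) \<le> (\<Sum>i\<in>G. l2norm (F i))"
  using assms
proof (induction G rule: infinite_finite_induct)
  case (insert i G)
  have "l2norm (\<lambda>t. F i t + (\<Sum>i\<in>G. F i t)) \<le> l2norm (F i) + l2norm (\<lambda>t. \<Sum>i\<in>G. F i t)"
    using insert.prems by (intro l2norm_triangle_ineq L2_sum) auto
  with insert show ?case by simp
qed auto

lemma l2norm_tendsto:
  assumes "L2 f" "\<And>n. L2 (F n)" "(\<lambda>n. l2norm (\<lambda>t. f t - F n t)) \<longlonglongrightarrow> 0"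
  shows "(\<lambda>n. l2norm (F n)) \<longlonglongrightarrow> l2norm f"
proof -
  have "(\<lambda>n. l2norm (F n) - l2norm f) \<longlonglongrightarrow> 0"
    using assms(3)
    by (rule Lim_null_comparison[OF always_eventually, rotated])
      (use l2norm_triangle_ineq3[OF assms(1,2)] in \<open>auto simp: abs_minus_commute\<close>)
  then show ?thesis
    by (simp add: LIM_zero_iff)
qed

lemma l2norm_cong_AE:
  assumes "L2 f" "L2 h" "AE t in lborel. f t = h t"
  shows "l2norm f = l2norm h"
  unfolding l2norm_def using assms
  by (intro arg_cong[where f = sqrt] integral_cong_AE) (auto simp: L2_def)

lemma l2inner_cong_AE:
  assumes "L2 f" "L2 h" "L2 k" "AE t in lborel. f t = h t"
  shows "l2inner f k = l2inner h k"
proof -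
  note [measurable] = assms(1-3)[THEN L2_measurable]
  show ?thesis
    unfolding l2inner_def using assms(4) by (intro integral_cong_AE) auto
qed

lemma l2inner_sum_left:
  assumes "\<And>i. i \<in> G \<Longrightarrow> L2 (F i)" "L2 h"
  shows "l2inner (\<lambda>t. \<Sum>i\<in>G. F i t) h = (\<Sum>i\<in>G. l2inner (F i) h)"
  using L2_l2inner_integrable[OF assms]
  by (simp add: l2inner_def sum_distrib_right Bochner_Integration.integral_sum)

lemma l2inner_cmult_left: "l2inner (\<lambda>t. a * f t) h = a * l2inner f h"
  by (simp add: l2inner_def mult.assoc)

lemma l2inner_diff_left:
  "L2 f \<Longrightarrow> L2 h \<Longrightarrow> L2 k \<Longrightarrow> l2inner (\<lambda>t. f t - h t) k = l2inner f k - l2inner h k"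
  using L2_l2inner_integrable[of f k] L2_l2inner_integrable[of h k]
  by (simp add: l2inner_def left_diff_distrib)

lemma l2inner_diff_right:
  "L2 f \<Longrightarrow> L2 h \<Longrightarrow> L2 k \<Longrightarrow> l2inner f (\<lambda>t. h t - k t) = l2inner f h - l2inner f k"
  using L2_l2inner_integrable[of f h] L2_l2inner_integrable[of f k]
  by (simp add: l2inner_def right_diff_distrib)

lemma L2_transl: "L2 h \<Longrightarrow> L2 (transl l h)"
  unfolding L2_def transl_def
  using lborel_integrable_affine[of "\<lambda>t. (cmod (h t))\<^sup>2" 1 "-l"] by auto

lemma L2_reflect: "L2 h \<Longrightarrow> L2 (reflect h)"
  unfolding L2_def reflect_def
  using lborel_integrable_affine[of "\<lambda>t. (cmod (h t))\<^sup>2" "-1" 0] by auto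

lemma l2norm_transl: "L2 h \<Longrightarrow> l2norm (transl l h) = l2norm h"
  unfolding l2norm_def transl_def using lborel_integral_shift[of "\<lambda>t. (cmod (h t))\<^sup>2" l] by auto

lemma l2norm_tendsto_0_dominated:
  fixes F :: "nat \<Rightarrow> 'd::finite sig"
  assumes [measurable]: "\<And>n. F n \<in> borel_measurable borel"
    and w_integrable: "integrable lborel w"
    and lim: "AE t in lborel. (\<lambda>n. F n t) \<longlonglongrightarrow> 0"
    and bound: "\<And>n t. (cmod (F n t))\<^sup>2 \<le> w t"
  shows "(\<lambda>n. l2norm (F n)) \<longlonglongrightarrow> 0"
proof -
  have "(\<lambda>n. LINT t|lborel. (cmod (F n t))\<^sup>2) \<longlonglongrightarrow> (LINT t|(lborel :: 'd rvec measure). 0)"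
  proof (rule integral_dominated_convergence[OF _ _ w_integrable])
    show "AE t in lborel. (\<lambda>n. (cmod (F n t))\<^sup>2) \<longlonglongrightarrow> 0"
      using lim
    proof eventually_elim
      case (elim t)
      from tendsto_power[OF tendsto_norm[OF this], of 2] show ?case by simp
    qed
    show "AE t in lborel. norm ((cmod (F n t))\<^sup>2) \<le> w t" for n
      using bound by auto
  qed measurable
  from tendsto_real_sqrt[OF this] show ?thesis
    by (simp add: l2norm_def)
qed

section \<open>The Fourier transform and the Gaussian\<close>

definition fourier :: "('a::euclidean_space \<Rightarrow> complex) \<Rightarrow> 'a \<Rightarrow> complex" where
  "fourier f \<omega> = (LINT t|lborel. f t * cis2pi (- (\<omega> \<bullet> t)))"

lemma fourier_measurable [measurable]:
  assumes [measurable]: "f \<in> borel_measurable borel"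
  shows "fourier f \<in> borel_measurable borel"
  unfolding fourier_def[abs_def] by measurable

lemma integrable_mult_cis2pi:
  fixes f :: "'a::euclidean_space \<Rightarrow> complex"
  assumes f_integrable: "integrable lborel f" and [measurable]: "p \<in> borel_measurable borel"
  shows "integrable lborel (\<lambda>t. f t * cis2pi (p t))"
proof (rule Bochner_Integration.integrable_bound[OF f_integrable])
  have [measurable]: "f \<in> borel_measurable borel" using f_integrable by auto
  show "(\<lambda>t. f t * cis2pi (p t)) \<in> borel_measurable lborel" by measurable
qed (simp add: norm_mult)

lemma norm_fourier_le: "cmod (fourier f \<omega>) \<le> (LINT t|lborel. cmod (f t))"
  unfolding fourier_def by (rule order_trans[OF integral_norm_bound]) (simp add: norm_mult)

lemma fourier_sum:
  assumes "\<And>i. i \<in> G \<Longrightarrow> integrable lborel (F i)"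
  shows "fourier (\<lambda>t. \<Sum>i\<in>G. c i * F i t) \<omega> = (\<Sum>i\<in>G. c i * fourier (F i) \<omega>)"
proof -
  have "integrable lborel (\<lambda>t. F i t * cis2pi (- (\<omega> \<bullet> t)))" if "i \<in> G" for i
    using assms[OF that] by (rule integrable_mult_cis2pi) measurable
  then show ?thesis
    by (simp add: fourier_def sum_distrib_right mult.assoc)
qed

lemma fourier_shift:
  assumes [measurable]: "f \<in> borel_measurable borel"
  shows "fourier (\<lambda>t. f (t - a)) \<omega> = cis2pi (- (\<omega> \<bullet> a)) * fourier f \<omega>"
proof -
  have "fourier (\<lambda>t. f (t - a)) \<omega> = (LINT t|lborel. (\<lambda>t. f t * cis2pi (- (\<omega> \<bullet> (t + a)))) (t - a))"
    by (simp add: fourier_def)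
  also have "\<dots> = (LINT t|lborel. f t * cis2pi (- (\<omega> \<bullet> (t + a))))"
    by (rule lborel_integral_shift) measurable
  also have "\<dots> = (LINT t|lborel. cis2pi (- (\<omega> \<bullet> a)) * (f t * cis2pi (- (\<omega> \<bullet> t))))"
  proof (rule Bochner_Integration.integral_cong[OF refl])
    fix t
    have "cis2pi (- (\<omega> \<bullet> (t + a))) = cis2pi (- (\<omega> \<bullet> a)) * cis2pi (- (\<omega> \<bullet> t))"
      by (simp add: inner_add_right algebra_simps flip: cis2pi_add)
    then show "f t * cis2pi (- (\<omega> \<bullet> (t + a))) = cis2pi (- (\<omega> \<bullet> a)) * (f t * cis2pi (- (\<omega> \<bullet> t)))"
      by (simp only: mult.left_commute)
  qed
  finally show ?thesis by (simp add: fourier_def)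
qed

lemma fourier_scale:
  fixes f :: "'a::euclidean_space \<Rightarrow> complex"
  assumes [measurable]: "f \<in> borel_measurable borel" and c_nonzero: "c \<noteq> 0"
  shows "fourier (\<lambda>t. f (c *\<^sub>R t)) \<omega> = (1 / \<bar>c\<bar> ^ DIM('a)) *\<^sub>R fourier f ((1 / c) *\<^sub>R \<omega>)"
proof -
  have "fourier f ((1 / c) *\<^sub>R \<omega>) = \<bar>c\<bar> ^ DIM('a) *\<^sub>R fourier (\<lambda>t. f (c *\<^sub>R t)) \<omega>"
    unfolding fourier_def using c_nonzero by (subst lborel_integral_affine[OF _ c_nonzero, of _ 0]) auto
  then show ?thesis
    using c_nonzero by simp
qed

lemma integral_fourier_mult:
  fixes f h :: "'a::euclidean_space \<Rightarrow> complex"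
  assumes f_integrable: "integrable lborel f" and h_integrable: "integrable lborel h"
  shows "(LINT \<omega>|lborel. fourier f \<omega> * h \<omega>) = (LINT t|lborel. f t * fourier h t)"
proof -
  have [measurable]: "f \<in> borel_measurable borel" "h \<in> borel_measurable borel"
    using f_integrable h_integrable by auto
  let ?F = "\<lambda>t \<omega>. f t * h \<omega> * cis2pi (- (\<omega> \<bullet> t))"
  have "integrable (lborel \<Otimes>\<^sub>M lborel) (\<lambda>(t, \<omega>). ?F t \<omega>)"
    by (rule Bochner_Integration.integrable_bound[OF integrable_lborel_tensor[OF f_integrable h_integrable]])
      (auto simp: norm_mult)
  then have "(LINT \<omega>|lborel. LINT t|lborel. ?F t \<omega>) = (LINT t|lborel. LINT \<omega>|lborel. ?F t \<omega>)"
    by (rule lborel_pair.Fubini_integral)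
  moreover have "(LINT t|lborel. ?F t \<omega>) = fourier f \<omega> * h \<omega>" for \<omega>
    unfolding fourier_def integral_mult_left_zero[symmetric] by (simp only: mult_ac)
  moreover have "(LINT \<omega>|lborel. ?F t \<omega>) = f t * fourier h t" for t
    unfolding fourier_def integral_mult_right_zero[symmetric] by (simp only: mult.assoc inner_commute)
  ultimately show ?thesis
    by simp
qed

definition gaussian :: "'a::euclidean_space \<Rightarrow> real" where
  "gaussian x = exp (- (pi * (x \<bullet> x)))"

lemma gaussian_pos [simp]: "0 < gaussian x"
  and gaussian_le_1 [simp]: "gaussian x \<le> 1"
  and gaussian_0 [simp]: "gaussian 0 = 1"
  by (simp_all add: gaussian_def)

lemma gaussian_measurable [measurable]: "gaussian \<in> borel_measurable borel"
  unfolding gaussian_def[abs_def] by measurable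

lemma integrable_gaussian_real: "integrable lborel (gaussian :: real \<Rightarrow> real)"
  and fourier_gaussian_real: "fourier (\<lambda>x::real. of_real (gaussian x)) \<omega> = of_real (gaussian \<omega>)"
proof -
  let ?s = "sqrt (2 * pi)"
  have gaussian_std_normal: "gaussian x = ?s * std_normal_density (0 + ?s *\<^sub>R x)" for x :: real
    by (simp add: gaussian_def std_normal_density_def power_mult_distrib power2_eq_square)
  show "integrable lborel (gaussian :: real \<Rightarrow> real)"
    unfolding gaussian_std_normal[abs_def] by (intro integrable_mult_right lborel_integrable_affine) auto
  have "of_real (exp (- ((?s * \<omega>)\<^sup>2) / 2)) = char std_normal_distribution (- (?s * \<omega>))"
    by (simp add: char_std_normal_distribution)
  also have "\<dots> = (LINT x|lborel. std_normal_density x *\<^sub>R iexp (- (?s * \<omega>) * x))"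
    unfolding char_def by (subst integral_density) auto
  also have "\<dots> = (LINT x|lborel. ?s *\<^sub>R (std_normal_density (0 + ?s *\<^sub>R x) *\<^sub>R
      iexp (- (?s * \<omega>) * (0 + ?s *\<^sub>R x))))"
    unfolding integral_scaleR_right by (subst lborel_integral_affine[of _ ?s 0]) auto
  also have "\<dots> = fourier (\<lambda>x. of_real (gaussian x)) \<omega>"
    unfolding fourier_def gaussian_std_normal
    by (intro Bochner_Integration.integral_cong refl)
      (simp add: cis2pi_def cis_conv_exp scaleR_conv_of_real mult_ac flip: of_real_mult)
  also have "exp (- ((?s * \<omega>)\<^sup>2) / 2) = gaussian \<omega>"
    by (simp add: gaussian_def power_mult_distrib power2_eq_square)
  finally show "fourier (\<lambda>x::real. of_real (gaussian x)) \<omega> = of_real (gaussian \<omega>)" ..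
qed

lemma gaussian_prod: "gaussian x = (\<Prod>b\<in>Basis. gaussian (x \<bullet> b))"
  by (simp add: gaussian_def euclidean_inner[of x x] sum_distrib_left exp_sum flip: sum_negf)

lemma integrable_gaussian: "integrable lborel (gaussian :: 'a::euclidean_space \<Rightarrow> real)"
  and fourier_gaussian:
    "fourier (\<lambda>x::'a. of_real (gaussian x)) \<omega> = of_real (gaussian \<omega>)"
proof -
  define f where "f b x = of_real (gaussian x) * cis2pi (- ((\<omega> \<bullet> b) * x))" for b :: 'a and x :: real
  have f_integrable: "integrable lborel (f b)" for b
    unfolding f_def[abs_def]
    by (intro integrable_mult_cis2pi integrable_of_real integrable_gaussian_real) measurable
  have prod_f: "(\<Prod>b\<in>Basis. f b (x \<bullet> b)) = of_real (gaussian x) * cis2pi (- (\<omega> \<bullet> x))" for x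
    by (simp add: f_def prod.distrib gaussian_prod[of x] cis2pi_def cis_conv_exp exp_sum
        euclidean_inner[of \<omega> x] sum_distrib_left flip: sum_negf)
  show "fourier (\<lambda>x::'a. of_real (gaussian x)) \<omega> = of_real (gaussian \<omega>)"
    using lborel_integral_prod_Basis[of f, OF f_integrable] fourier_gaussian_real unfolding prod_f
    by (simp add: fourier_def f_def gaussian_prod[of \<omega>])
  show "integrable lborel (gaussian :: 'a \<Rightarrow> real)"
    using integrable_norm[OF integrable_lborel_prod_Basis[of f, OF f_integrable]]
    by (simp add: prod_f norm_mult less_imp_le)
qed

lemma integrable_gaussian_scaled:
  "c \<noteq> 0 \<Longrightarrow> integrable lborel (\<lambda>x::'a::euclidean_space. gaussian (c *\<^sub>R x))"
  using lborel_integrable_affine[OF integrable_gaussian, of c 0] by simp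

lemma gaussian_scaleR_le:
  assumes "0 \<le> c" "c \<le> d"
  shows "gaussian (d *\<^sub>R x) \<le> gaussian (c *\<^sub>R x)"
proof -
  have "(c * c) * (x \<bullet> x) \<le> (d * d) * (x \<bullet> x)"
    using assms by (intro mult_right_mono mult_mono) auto
  then show ?thesis
    by (simp add: gaussian_def mult.assoc)
qed

lemma gaussian_scaleR_tendsto_1:
  assumes "\<epsilon> \<longlonglongrightarrow> 0"
  shows "(\<lambda>n. gaussian (\<epsilon> n *\<^sub>R x)) \<longlonglongrightarrow> 1"
proof -
  have "(\<lambda>n. gaussian (\<epsilon> n *\<^sub>R x)) \<longlonglongrightarrow> exp (- (pi * ((0 *\<^sub>R x) \<bullet> (0 *\<^sub>R x))))"
    unfolding gaussian_def by (intro tendsto_intros assms)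
  then show ?thesis by simp
qed

lemma integral_gaussian: "(LINT x|lborel. gaussian (x :: 'a::euclidean_space)) = 1"
proof -
  have "complex_of_real (LINT x|lborel. gaussian (x :: 'a)) = of_real 1"
    using fourier_gaussian[of "0 :: 'a"] by (simp add: fourier_def)
  then show ?thesis
    by (simp only: of_real_eq_iff)
qed

lemma L2_gaussian: "L2 (\<lambda>t. of_real (gaussian t))"
  unfolding L2_def
proof
  show "integrable lborel (\<lambda>t::'a rvec. (cmod (of_real (gaussian t)))\<^sup>2)"
  proof (rule Bochner_Integration.integrable_bound[OF integrable_gaussian])
    have "(gaussian t)\<^sup>2 \<le> gaussian t" for t :: "'a rvec"
      by (simp add: power2_eq_square mult_left_le less_imp_le)
    then show "AE t::'a rvec in lborel. norm ((cmod (of_real (gaussian t)))\<^sup>2) \<le> norm (gaussian t)"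
      by (simp add: less_imp_le)
  qed measurable
qed measurable

lemma gaussian_approximate_identity:
  fixes r :: "'a::euclidean_space \<Rightarrow> complex"
  assumes [measurable]: "r \<in> borel_measurable borel" and bound: "\<And>x. cmod (r x) \<le> B"
    and cont: "isCont r 0" and \<epsilon>_lim: "\<epsilon> \<longlonglongrightarrow> 0"
  shows "(\<lambda>n. LINT u|lborel. of_real (gaussian u) * r (\<epsilon> n *\<^sub>R u)) \<longlonglongrightarrow> r 0"
proof -
  have "(\<lambda>n. LINT u|lborel. of_real (gaussian u) * r (\<epsilon> n *\<^sub>R u))
      \<longlonglongrightarrow> (LINT u|lborel. of_real (gaussian (u :: 'a)) * r 0)"
  proof (rule integral_dominated_convergence)
    show "integrable lborel (\<lambda>u::'a. gaussian u * B)"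
      by (intro integrable_mult_left integrable_gaussian)
    show "AE u in lborel. (\<lambda>n. of_real (gaussian u) * r (\<epsilon> n *\<^sub>R u)) \<longlonglongrightarrow> of_real (gaussian u) * r 0"
    proof (intro AE_I2 tendsto_intros isCont_tendsto_compose[OF cont])
      show "(\<lambda>n. \<epsilon> n *\<^sub>R u) \<longlonglongrightarrow> 0" for u :: 'a
        using tendsto_scaleR[OF \<epsilon>_lim tendsto_const[of u]] by simp
    qed
    show "AE u in lborel. norm (of_real (gaussian u) * r (\<epsilon> n *\<^sub>R u)) \<le> gaussian u * B" for n
      using bound by (simp add: norm_mult less_imp_le)
  qed measurable
  then show ?thesis
    by (simp add: integral_gaussian)
qed

section \<open>Completeness\<close>

definition L2_Cauchy :: "(nat \<Rightarrow> 'd::finite sig) \<Rightarrow> bool" where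
  "L2_Cauchy F \<longleftrightarrow> (\<forall>e>0. \<exists>N. \<forall>m\<ge>N. \<forall>n\<ge>N. l2norm (\<lambda>t. F m t - F n t) < e)"

lemma L2_CauchyD:
  assumes "L2_Cauchy F" "0 < e"
  obtains N where "\<And>m n. m \<ge> N \<Longrightarrow> n \<ge> N \<Longrightarrow> l2norm (\<lambda>t. F m t - F n t) < e"
  using assms unfolding L2_Cauchy_def by blast

lemma L2_CauchyI:
  assumes L2_F: "\<And>n. L2 (F n)"
    and tail: "\<And>m n. n \<le> m \<Longrightarrow> l2norm (\<lambda>t. F m t - F n t) < inverse (real (Suc n))"
  shows "L2_Cauchy F"
  unfolding L2_Cauchy_def
proof (intro allI impI)
  fix e :: real assume "0 < e"
  obtain N where N: "inverse (real (Suc N)) < e / 2"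
    using reals_Archimedean[OF half_gt_zero[OF \<open>0 < e\<close>]] by blast
  have "l2norm (\<lambda>t. F m t - F n t) < e" if "m \<ge> N" "n \<ge> N" for m n
    using l2norm_diff_triangle[OF L2_F[of m] L2_F[of N] L2_F[of n]] N
      tail[OF that(1)] tail[OF that(2)] l2norm_diff_commute[of "F N" "F n"]
    by linarith
  then show "\<exists>N. \<forall>m\<ge>N. \<forall>n\<ge>N. l2norm (\<lambda>t. F m t - F n t) < e" by blast
qed

lemma L2_Cauchy_AE_subsequence:
  fixes F :: "nat \<Rightarrow> 'd::finite sig"
  assumes L2_F: "\<And>n. L2 (F n)" and Cauchy: "L2_Cauchy F"
  obtains r where "strict_mono r" "AE t in lborel. convergent (\<lambda>k. F (r k) t)"
proof -
  \<comment> \<open>A positive square integrable weight turns the sequence into a Cauchy sequence in \<open>L\<^sup>1\<close>.\<close>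
  define w :: "'d sig" where "w t = of_real (gaussian t)" for t
  have w: "L2 w" "\<And>t. w t \<noteq> 0"
    using L2_gaussian less_imp_neq[OF gaussian_pos] by (auto simp: w_def[abs_def])
  have weighted_L1_le: "(LINT t|lborel. norm (F m t * w t - F n t * w t))
      \<le> l2norm (\<lambda>t. F m t - F n t) * (l2norm w + 1)" for m n
  proof -
    have "(LINT t|lborel. norm (F m t * w t - F n t * w t)) \<le> l2norm (\<lambda>t. F m t - F n t) * l2norm w"
      using integral_norm_mult_le_l2norm[OF L2_diff[OF L2_F[of m] L2_F[of n]] w(1)]
      by (simp add: left_diff_distrib)
    also have "\<dots> \<le> l2norm (\<lambda>t. F m t - F n t) * (l2norm w + 1)"
      by (intro mult_left_mono) auto
    finally show ?thesis .
  qed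
  have L1_Cauchy: "\<exists>N. \<forall>m\<ge>N. \<forall>n\<ge>N. (LINT t|lborel. norm (F m t * w t - F n t * w t)) < e"
    if "0 < e" for e
  proof -
    have pos: "0 < l2norm w + 1"
      by (simp add: add_nonneg_pos)
    obtain N where "\<And>m n. m \<ge> N \<Longrightarrow> n \<ge> N \<Longrightarrow> l2norm (\<lambda>t. F m t - F n t) < e / (l2norm w + 1)"
      using L2_CauchyD[OF Cauchy divide_pos_pos[OF \<open>0 < e\<close> pos]] by blast
    then show ?thesis
      using weighted_L1_le pos by (simp add: pos_less_divide_eq) (meson le_less_trans)
  qed
  obtain r where r: "strict_mono r" and AE_Cauchy: "AE t in lborel. Cauchy (\<lambda>k. F (r k) t * w t)"
    by (rule cauchy_L1_AE_cauchy_subseq[of lborel "\<lambda>n t. F n t * w t"])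
      (use L2_mult_integrable[OF L2_F w(1)] L1_Cauchy in auto)
  from AE_Cauchy have "AE t in lborel. convergent (\<lambda>k. F (r k) t)"
  proof eventually_elim
    case (elim t)
    then show ?case
      using w(2) by (simp add: Cauchy_convergent_iff convergent_mult_const_right_iff)
  qed
  with r show thesis ..
qed

lemma
  fixes F :: "nat \<Rightarrow> 'd::finite sig"
  assumes L2_F: "\<And>n. L2 (F n)" and [measurable]: "f \<in> borel_measurable borel"
    and lim: "AE t in lborel. (\<lambda>n. F n t) \<longlonglongrightarrow> f t"
    and bound: "\<forall>\<^sub>F n in sequentially. l2norm (F n) \<le> B"
  shows L2_AE_limit: "L2 f" and l2norm_AE_limit_le: "l2norm f \<le> B"
proof -
  note [measurable] = L2_F[THEN L2_measurable]
  have "0 \<le> B"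
    using eventually_happens[OF bound] order_trans[OF l2norm_nonneg] by auto
  have "(\<integral>\<^sup>+t. ennreal ((cmod (f t))\<^sup>2) \<partial>lborel)
      = (\<integral>\<^sup>+t. liminf (\<lambda>n. ennreal ((cmod (F n t))\<^sup>2)) \<partial>lborel)"
  proof (rule nn_integral_cong_AE, use lim in eventually_elim)
    case (elim t)
    then have "(\<lambda>n. ennreal ((cmod (F n t))\<^sup>2)) \<longlonglongrightarrow> ennreal ((cmod (f t))\<^sup>2)"
      by (intro tendsto_intros)
    then show ?case
      by (intro lim_imp_Liminf[symmetric] trivial_limit_sequentially)
  qed
  also have "\<dots> \<le> liminf (\<lambda>n. \<integral>\<^sup>+t. ennreal ((cmod (F n t))\<^sup>2) \<partial>lborel)"
    by (rule nn_integral_liminf) measurable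
  also have "\<dots> \<le> liminf (\<lambda>n. ennreal (B\<^sup>2))"
    using bound unfolding ennreal_l2norm_square[OF L2_F, symmetric]
    by (intro Liminf_mono) (auto elim!: eventually_mono intro: ennreal_leI power_mono)
  finally have "(\<integral>\<^sup>+t. ennreal ((cmod (f t))\<^sup>2) \<partial>lborel) \<le> ennreal (B\<^sup>2)"
    by (simp add: Liminf_const)
  then show "L2 f" "l2norm f \<le> B"
    using L2_nn_integral_leI[of f B] l2norm_nn_integral_leI[of f B] \<open>0 \<le> B\<close> by auto
qed

lemma L2_complete:
  fixes F :: "nat \<Rightarrow> 'd::finite sig"
  assumes L2_F: "\<And>n. L2 (F n)" and Cauchy: "L2_Cauchy F"
  obtains f where "L2 f" "(\<lambda>n. l2norm (\<lambda>t. f t - F n t)) \<longlonglongrightarrow> 0"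
proof -
  note [measurable] = L2_F[THEN L2_measurable]
  obtain r where r: "strict_mono r" and conv: "AE t in lborel. convergent (\<lambda>k. F (r k) t)"
    using L2_Cauchy_AE_subsequence[OF L2_F Cauchy] by blast
  define f where "f t = lim (\<lambda>k. F (r k) t)" for t
  have [measurable]: "f \<in> borel_measurable borel"
    unfolding f_def by measurable
  have lim: "AE t in lborel. (\<lambda>k. F (r k) t - F n t) \<longlonglongrightarrow> f t - F n t" for n
    using conv by eventually_elim (auto simp: f_def convergent_LIMSEQ_iff intro: tendsto_diff)
  have near: "\<forall>\<^sub>F k in sequentially. l2norm (\<lambda>t. F (r k) t - F n t) \<le> e"
    if "\<And>m. m \<ge> N \<Longrightarrow> l2norm (\<lambda>t. F m t - F n t) < e" for N n e
    using that seq_suble[OF r] by (intro eventually_sequentiallyI[of N]) (auto intro: less_imp_le order_trans)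
  note limit = L2_AE_limit[OF L2_diff[OF L2_F L2_F] _ lim near]
    l2norm_AE_limit_le[OF L2_diff[OF L2_F L2_F] _ lim near]
  show thesis
  proof
    obtain N where N: "\<And>m n. m \<ge> N \<Longrightarrow> n \<ge> N \<Longrightarrow> l2norm (\<lambda>t. F m t - F n t) < 1"
      using L2_CauchyD[OF Cauchy zero_less_one] by blast
    have "L2 (\<lambda>t. f t - F N t)"
      by (rule limit(1)[OF _ N[OF _ order_refl]]) measurable
    from L2_add[OF this L2_F[of N]] show "L2 f" by simp
    show "(\<lambda>n. l2norm (\<lambda>t. f t - F n t)) \<longlonglongrightarrow> 0"
    proof (rule LIMSEQ_I)
      fix e :: real assume "0 < e"
      obtain N where N: "\<And>m n. m \<ge> N \<Longrightarrow> n \<ge> N \<Longrightarrow> l2norm (\<lambda>t. F m t - F n t) < e / 2"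
        using L2_CauchyD[OF Cauchy half_gt_zero[OF \<open>0 < e\<close>]] by blast
      have "l2norm (\<lambda>t. f t - F n t) \<le> e / 2" if "n \<ge> N" for n
        by (rule limit(2)[OF _ N[OF _ that]]) measurable
      then show "\<exists>N. \<forall>n\<ge>N. norm (l2norm (\<lambda>t. f t - F n t) - 0) < e"
        using \<open>0 < e\<close> by (intro exI[of _ N]) force
    qed
  qed
qed

section \<open>Continuity of translations\<close>

lemma L2_bounded_support:
  assumes [measurable]: "f \<in> borel_measurable borel" "X \<in> sets borel" and X_bounded: "bounded X"
    and f_le: "\<And>t. cmod (f t) \<le> B" and support: "\<And>t. t \<notin> X \<Longrightarrow> f t = 0"
  shows "L2 f"
proof -
  have "integrable lborel (\<lambda>t. (cmod (f t))\<^sup>2)"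
    by (rule integrableI_bounded_set[of X _ _ "B\<^sup>2"])
      (use emeasure_bounded_finite[OF X_bounded] f_le support in \<open>auto intro!: AE_I2 power_mono\<close>)
  then show ?thesis
    by (simp add: L2_def)
qed

lemma l2norm_tendsto_0_bounded_support:
  fixes F :: "nat \<Rightarrow> 'd::finite sig"
  assumes "\<And>n. F n \<in> borel_measurable borel" and X: "X \<in> sets borel" "bounded X"
    and F_le: "\<And>n t. cmod (F n t) \<le> B" and support: "\<And>n t. t \<notin> X \<Longrightarrow> F n t = 0"
    and "AE t in lborel. (\<lambda>n. F n t) \<longlonglongrightarrow> 0"
  shows "(\<lambda>n. l2norm (F n)) \<longlonglongrightarrow> 0"
proof (rule l2norm_tendsto_0_dominated[where w = "\<lambda>t. B\<^sup>2 * indicator X t"])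
  show "integrable lborel (\<lambda>t. B\<^sup>2 * indicator X t)"
    using X emeasure_bounded_finite[of X] by (intro integrable_mult_right) auto
  show "(cmod (F n t))\<^sup>2 \<le> B\<^sup>2 * indicator X t" for n t
    using power_mono[OF F_le[of n t] norm_ge_zero, of 2] support[of t n] by (cases "t \<in> X") auto
qed (use assms in auto)

lemma L2_indicator_mult: "L2 f \<Longrightarrow> X \<in> sets borel \<Longrightarrow> L2 (\<lambda>t. indicator X t * f t)"
  by (rule L2_bounded_mult[where K = 1]) (auto simp: indicator_def)

lemma integrable_indicator_mult_L2:
  assumes L2_f: "L2 f" and X: "X \<in> sets borel" "bounded X"
  shows "integrable lborel (\<lambda>t. indicator X t * f t)"
proof (rule L2_mult_integrable[OF _ L2_f])
  show "L2 (indicator X)"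
    by (rule L2_bounded_support[where B = 1, OF _ X]) (use X in \<open>auto simp: indicator_def\<close>)
qed

lemma l2norm_diff_indicator_tendsto_0:
  assumes L2_f: "L2 f" and [measurable]: "\<And>n. X n \<in> sets borel"
    and exhaust: "\<And>t. \<forall>\<^sub>F n in sequentially. t \<in> X n"
  shows "(\<lambda>n. l2norm (\<lambda>t. f t - indicator (X n) t * f t)) \<longlonglongrightarrow> 0"
proof (rule l2norm_tendsto_0_dominated[where w = "\<lambda>t. (cmod (f t))\<^sup>2"])
  note [measurable] = L2_measurable[OF L2_f]
  show "(\<lambda>t. f t - indicator (X n) t * f t) \<in> borel_measurable borel" for n
    by measurable
  have "(\<lambda>n. f t - indicator (X n) t * f t) \<longlonglongrightarrow> 0" for t
    by (rule tendsto_eventually, rule eventually_mono[OF exhaust[of t]]) simp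
  then show "AE t in lborel. (\<lambda>n. f t - indicator (X n) t * f t) \<longlonglongrightarrow> 0"
    by simp
qed (use L2_f in \<open>auto simp: L2_def indicator_def\<close>)

lemma borel_measurable_AE_limit_continuous:
  fixes f :: "'a::euclidean_space \<Rightarrow> 'b::euclidean_space"
  assumes "f \<in> borel_measurable borel"
  obtains k where "\<And>n::nat. continuous_on UNIV (k n)" "AE t in lborel. (\<lambda>n. k n t) \<longlonglongrightarrow> f t"
proof -
  have "f measurable_on UNIV"
    using assms by (intro lebesgue_measurable_imp_measurable_on measurable_completion) auto
  then obtain N k where N_negligible: "negligible N" and k_cont: "\<And>n. continuous_on UNIV (k n)"
      and lim: "\<And>t. t \<notin> N \<Longrightarrow> (\<lambda>n. k n t) \<longlonglongrightarrow> f t"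
    unfolding measurable_on_def by auto
  have "AE t in lebesgue. t \<notin> N"
    using N_negligible by (auto simp: negligible_iff_null_sets intro: AE_not_in)
  then have "AE t in lborel. t \<notin> N"
    by (simp add: AE_completion_iff)
  then have "AE t in lborel. (\<lambda>n. k n t) \<longlonglongrightarrow> f t"
    by eventually_elim (rule lim)
  with k_cont show thesis
    by (rule that)
qed

lemma bounded_support_AE_limit_continuous:
  fixes f :: "'a::euclidean_space \<Rightarrow> 'b::euclidean_space"
  assumes [measurable]: "f \<in> borel_measurable borel"
    and f_le: "\<And>t. norm (f t) \<le> B" and support: "\<And>t. t \<notin> cball 0 R \<Longrightarrow> f t = 0"
  obtains \<phi> where "\<And>n::nat. continuous_on UNIV (\<phi> n)" "\<And>n t. norm (\<phi> n t) \<le> B"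
    "\<And>n t. t \<notin> cball 0 (R + 1) \<Longrightarrow> \<phi> n t = 0" "AE t in lborel. (\<lambda>n. \<phi> n t) \<longlonglongrightarrow> f t"
proof -
  obtain k where k_cont: "\<And>n::nat. continuous_on UNIV (k n)" and lim: "AE t in lborel. (\<lambda>n. k n t) \<longlonglongrightarrow> f t"
    using borel_measurable_AE_limit_continuous[of f] by auto
  have "0 \<le> B"
    by (rule order_trans[OF norm_ge_zero f_le[of 0]])
  define clip where "clip = closest_point (cball (0::'b) B)"
  define cutoff where "cutoff t = max 0 (min 1 (R + 1 - norm t))" for t :: 'a
  define \<phi> where "\<phi> n t = cutoff t *\<^sub>R clip (k n t)" for n t
  have clip_cont: "continuous_on T clip" for T
    unfolding clip_def using \<open>0 \<le> B\<close> by (intro continuous_on_closest_point) auto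
  have clip_le: "norm (clip z) \<le> B" for z
    using closest_point_in_set[of "cball (0::'b) B" z] \<open>0 \<le> B\<close> by (simp add: clip_def)
  have "continuous_on UNIV (\<phi> n)" for n
    unfolding \<phi>_def cutoff_def
    by (intro continuous_intros continuous_on_compose2[OF clip_cont k_cont]) auto
  moreover have "norm (\<phi> n t) \<le> B" for n t
    using mult_mono[OF _ clip_le[of "k n t"], of "cutoff t" 1] by (simp add: \<phi>_def cutoff_def)
  moreover have "\<phi> n t = 0" if "t \<notin> cball 0 (R + 1)" for n t
    using that by (simp add: \<phi>_def cutoff_def)
  moreover have "AE t in lborel. (\<lambda>n. \<phi> n t) \<longlonglongrightarrow> f t"
    using lim
  proof eventually_elim
    case (elim t)
    have "isCont clip (f t)"
      using clip_cont[of UNIV] by (simp add: continuous_on_eq_continuous_at)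
    then have "(\<lambda>n. \<phi> n t) \<longlonglongrightarrow> cutoff t *\<^sub>R clip (f t)"
      unfolding \<phi>_def by (intro tendsto_intros isCont_tendsto_compose[of _ clip] elim)
    moreover have "clip (f t) = f t"
      using f_le[of t] by (simp add: clip_def closest_point_self)
    moreover have "cutoff t *\<^sub>R f t = f t"
      using support[of t] by (cases "t \<in> cball 0 R") (auto simp: cutoff_def)
    ultimately show ?case
      by simp
  qed
  ultimately show thesis
    by (rule that)
qed

lemma L2_approx_bounded_support:
  assumes L2_f: "L2 f" and "0 < e"
  obtains h :: "'d::finite sig" and R :: real where
    "L2 h" "\<And>t. cmod (h t) \<le> R" "\<And>t. t \<notin> cball 0 R \<Longrightarrow> h t = 0" "l2norm (\<lambda>t. f t - h t) < e"
proof -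
  note [measurable] = L2_measurable[OF L2_f]
  define X where "X n = {t. cmod (f t) \<le> real n \<and> norm t \<le> real n}" for n
  have X_borel [measurable]: "X n \<in> sets borel" for n
    unfolding X_def by measurable
  have "\<forall>\<^sub>F n in sequentially. t \<in> X n" for t
  proof -
    obtain N :: nat where "max (cmod (f t)) (norm t) \<le> real N"
      using real_arch_simple by blast
    then show ?thesis
      by (intro eventually_sequentiallyI[of N]) (auto simp: X_def)
  qed
  from order_tendstoD(2)[OF l2norm_diff_indicator_tendsto_0[OF L2_f X_borel this] \<open>0 < e\<close>]
  obtain n where n: "l2norm (\<lambda>t. f t - indicator (X n) t * f t) < e"
    by (auto simp: eventually_sequentially)
  show thesis
    by (rule that[OF L2_indicator_mult[OF L2_f X_borel], of n "real n"])
      (use n in \<open>auto simp: X_def indicator_def\<close>)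
qed

lemma L2_approx_continuous:
  assumes L2_f: "L2 f" and "0 < e"
  obtains \<phi> :: "'d::finite sig" and B R :: real where
    "continuous_on UNIV \<phi>" "L2 \<phi>" "\<And>t. cmod (\<phi> t) \<le> B" "\<And>t. t \<notin> cball 0 R \<Longrightarrow> \<phi> t = 0"
    "l2norm (\<lambda>t. f t - \<phi> t) < e"
proof -
  obtain h :: "'d sig" and R where h: "L2 h" "\<And>t. cmod (h t) \<le> R" "\<And>t. t \<notin> cball 0 R \<Longrightarrow> h t = 0"
      and h_near: "l2norm (\<lambda>t. f t - h t) < e / 2"
    using L2_approx_bounded_support[OF L2_f, of "e/2"] \<open>0 < e\<close> by auto
  obtain \<phi> where \<phi>: "\<And>n. continuous_on UNIV (\<phi> n)" "\<And>n t. cmod (\<phi> n t) \<le> R"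
      "\<And>n t. t \<notin> cball 0 (R + 1) \<Longrightarrow> \<phi> n t = 0" and lim: "AE t in lborel. (\<lambda>n. \<phi> n t) \<longlonglongrightarrow> h t"
    using bounded_support_AE_limit_continuous[OF L2_measurable[OF h(1)] h(2,3)] by blast
  note [measurable] = L2_measurable[OF h(1)] borel_measurable_continuous_onI[OF \<phi>(1)]
  have L2_\<phi>: "L2 (\<phi> n)" for n
    by (rule L2_bounded_support[where X = "cball 0 (R + 1)", OF _ _ _ \<phi>(2,3)]) auto
  have "(\<lambda>n. l2norm (\<lambda>t. h t - \<phi> n t)) \<longlonglongrightarrow> 0"
  proof (rule l2norm_tendsto_0_bounded_support[where X = "cball 0 (R + 1)" and B = "R + R"])
    show "cmod (h t - \<phi> n t) \<le> R + R" for n t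
      using norm_triangle_le_diff[OF add_mono[OF h(2) \<phi>(2)]] .
    show "AE t in lborel. (\<lambda>n. h t - \<phi> n t) \<longlonglongrightarrow> 0"
      using lim by eventually_elim (auto intro: tendsto_eq_intros)
  qed (use h(3) \<phi>(3) in auto)
  from order_tendstoD(2)[OF this, of "e/2"] \<open>0 < e\<close>
  obtain n where "l2norm (\<lambda>t. h t - \<phi> n t) < e / 2"
    by (auto simp: eventually_sequentially)
  then have "l2norm (\<lambda>t. f t - \<phi> n t) < e"
    using l2norm_diff_triangle[OF L2_f h(1) L2_\<phi>, of n] h_near by linarith
  with \<phi>(1) L2_\<phi> \<phi>(2,3) show thesis
    by (rule that)
qed

lemma continuous_bounded_support_transl_tendsto:
  fixes \<phi> :: "'d::finite sig"
  assumes cont: "continuous_on UNIV \<phi>" and \<phi>_le: "\<And>t. cmod (\<phi> t) \<le> B"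
    and support: "\<And>t. t \<notin> cball 0 R \<Longrightarrow> \<phi> t = 0" and X_lim: "X \<longlonglongrightarrow> 0"
  shows "(\<lambda>n. l2norm (\<lambda>t. \<phi> t - transl (X n) \<phi> t)) \<longlonglongrightarrow> 0"
proof -
  note [measurable] = borel_measurable_continuous_onI[OF cont]
  obtain L where X_le: "\<And>n. norm (X n) \<le> L"
    using convergent_imp_Bseq[OF convergentI[OF X_lim]] by (auto simp: Bseq_def)
  show ?thesis
  proof (rule l2norm_tendsto_0_bounded_support[where X = "cball 0 (R + L)" and B = "B + B"])
    show "(\<lambda>t. \<phi> t - transl (X n) \<phi> t) \<in> borel_measurable borel" for n
      unfolding transl_def by measurable
    show "cmod (\<phi> t - transl (X n) \<phi> t) \<le> B + B" for n t
      unfolding transl_def using norm_triangle_le_diff[OF add_mono[OF \<phi>_le \<phi>_le]] .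
    show "\<phi> t - transl (X n) \<phi> t = 0" if "t \<notin> cball 0 (R + L)" for n t
    proof -
      have "norm (t - X n) > R" "norm t > R"
        using that norm_triangle_ineq2[of t "X n"] X_le[of n] norm_ge_zero[of "X n"]
        unfolding mem_cball_0 by linarith+
      then show ?thesis by (simp add: transl_def support)
    qed
    have "(\<lambda>n. \<phi> t - transl (X n) \<phi> t) \<longlonglongrightarrow> 0" for t
    proof -
      have "(\<lambda>n. \<phi> (t - X n)) \<longlonglongrightarrow> \<phi> (t - 0)"
        using cont by (intro isCont_tendsto_compose[of _ \<phi>] tendsto_intros X_lim)
          (auto simp: continuous_on_eq_continuous_at)
      from tendsto_diff[OF tendsto_const[of "\<phi> t"] this] show ?thesis
        by (simp add: transl_def)
    qed
    then show "AE t in lborel. (\<lambda>n. \<phi> t - transl (X n) \<phi> t) \<longlonglongrightarrow> 0"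
      by simp
  qed auto
qed

lemma L2_transl_tendsto:
  fixes f :: "'d::finite sig"
  assumes L2_f: "L2 f" and X_lim: "X \<longlonglongrightarrow> 0"
  shows "(\<lambda>n. l2norm (\<lambda>t. f t - transl (X n) f t)) \<longlonglongrightarrow> 0"
proof (rule LIMSEQ_I)
  fix e :: real assume "0 < e"
  obtain \<phi> B R where \<phi>: "continuous_on UNIV \<phi>" "L2 \<phi>" "\<And>t. cmod (\<phi> t) \<le> B" "\<And>t. t \<notin> cball 0 R \<Longrightarrow> \<phi> t = 0"
      and \<phi>_near: "l2norm (\<lambda>t. f t - \<phi> t) < e / 3"
    using L2_approx_continuous[OF L2_f, of "e/3"] \<open>0 < e\<close> by auto
  have "(\<lambda>n. l2norm (\<lambda>t. \<phi> t - transl (X n) \<phi> t)) \<longlonglongrightarrow> 0"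
    by (rule continuous_bounded_support_transl_tendsto[OF \<phi>(1,3,4) X_lim])
  from order_tendstoD(2)[OF this, of "e/3"] \<open>0 < e\<close>
  obtain N where N: "\<And>n. n \<ge> N \<Longrightarrow> l2norm (\<lambda>t. \<phi> t - transl (X n) \<phi> t) < e / 3"
    by (auto simp: eventually_sequentially)
  have "norm (l2norm (\<lambda>t. f t - transl (X n) f t) - 0) < e" if "n \<ge> N" for n
  proof -
    note T = L2_transl[OF L2_f, of "X n"] L2_transl[OF \<phi>(2), of "X n"]
    have "(\<lambda>t. transl (X n) \<phi> t - transl (X n) f t) = transl (X n) (\<lambda>t. \<phi> t - f t)"
      by (simp add: transl_def)
    then have "l2norm (\<lambda>t. transl (X n) \<phi> t - transl (X n) f t) < e / 3"
      using \<phi>_near by (simp add: l2norm_transl[OF L2_diff[OF \<phi>(2) L2_f]] l2norm_diff_commute[of f])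
    then show ?thesis
      using l2norm_diff_triangle[OF L2_f \<phi>(2) T(1)] l2norm_diff_triangle[OF \<phi>(2) T(2,1)] \<phi>_near N[OF that]
      by simp
  qed
  then show "\<exists>N. \<forall>n\<ge>N. norm (l2norm (\<lambda>t. f t - transl (X n) f t) - 0) < e"
    by blast
qed

section \<open>Plancherel's theorem\<close>

definition autocorr :: "'d::finite sig \<Rightarrow> 'd sig" where
  "autocorr f x = l2inner f (transl x f)"

lemma autocorr_measurable [measurable]:
  assumes [measurable]: "f \<in> borel_measurable borel"
  shows "autocorr f \<in> borel_measurable borel"
  unfolding autocorr_def[abs_def] l2inner_def transl_def by measurable

lemma autocorr_0: "autocorr f 0 = of_real ((l2norm f)\<^sup>2)"
  by (simp add: autocorr_def transl_def l2inner_self)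

lemma norm_autocorr_le: "L2 f \<Longrightarrow> cmod (autocorr f x) \<le> (l2norm f)\<^sup>2"
  using norm_l2inner_le[OF _ L2_transl, of f f x] by (simp add: autocorr_def l2norm_transl power2_eq_square)

lemma isCont_autocorr_0:
  assumes L2_f: "L2 f"
  shows "isCont (autocorr f) 0"
proof (rule continuous_at_sequentiallyI)
  fix X :: "nat \<Rightarrow> 'a rvec" assume X: "X \<longlonglongrightarrow> 0"
  have autocorr_diff_le: "cmod (autocorr f (X n) - autocorr f 0)
      \<le> l2norm f * l2norm (\<lambda>t. f t - transl (X n) f t)" for n
  proof -
    note T = L2_transl[OF L2_f, of "X n"]
    have "autocorr f 0 - autocorr f (X n) = l2inner f (\<lambda>t. f t - transl (X n) f t)"
      by (simp add: autocorr_def l2inner_diff_right L2_f T) (simp add: transl_def)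
    then show ?thesis
      using norm_l2inner_le[OF L2_f L2_diff[OF L2_f T]] by (simp add: norm_minus_commute)
  qed
  have "(\<lambda>n. autocorr f (X n) - autocorr f 0) \<longlonglongrightarrow> 0"
    by (rule Lim_null_comparison[OF always_eventually[OF allI[OF autocorr_diff_le]]
          tendsto_mult_right_zero[OF L2_transl_tendsto[OF L2_f X]]])
  then show "(\<lambda>n. autocorr f (X n)) \<longlonglongrightarrow> autocorr f 0"
    by (simp add: LIM_zero_iff)
qed

lemma integrable_convolution_kernel:
  fixes f h :: "'a::euclidean_space \<Rightarrow> complex"
  assumes f_integrable: "integrable lborel f" and h_integrable: "integrable lborel h"
  shows "integrable (lborel \<Otimes>\<^sub>M lborel) (\<lambda>(s, x). f s * h (s - x))"
proof -
  have [measurable]: "f \<in> borel_measurable borel" "h \<in> borel_measurable borel"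
    using f_integrable h_integrable by auto
  have h_reflect: "integrable lborel (\<lambda>x. h (s - x))" for s
    using lborel_integrable_affine[OF h_integrable, of "-1" s] by simp
  have norm_reflect: "(LINT x|lborel. cmod (h (s - x))) = (LINT x|lborel. cmod (h x))" for s
    by (rule lborel_integral_reflect_shift) measurable
  show ?thesis
    by (rule lborel_pair.Fubini_integrable) (use f_integrable h_reflect in \<open>auto simp: norm_mult norm_reflect\<close>)
qed

lemma
  fixes f :: "'d::finite sig"
  assumes f_integrable: "integrable lborel f"
  shows integrable_autocorr: "integrable lborel (autocorr f)"
    and fourier_autocorr: "fourier (autocorr f) \<omega> = of_real ((cmod (fourier f \<omega>))\<^sup>2)"
proof -
  have [measurable]: "f \<in> borel_measurable borel" using f_integrable by auto
  let ?P = "\<lambda>s x. f s * cnj (f (s - x))" and ?e = "\<lambda>x. cis2pi (- (\<omega> \<bullet> x))"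
  have autocorr_eq: "autocorr f x = (LINT s|lborel. ?P s x)" for x
    by (simp add: autocorr_def l2inner_def transl_def)
  have P_integrable: "integrable (lborel \<Otimes>\<^sub>M lborel) (\<lambda>(s, x). ?P s x)"
    using f_integrable by (intro integrable_convolution_kernel) auto
  from lborel_pair.integrable_snd[OF this] show "integrable lborel (autocorr f)"
    by (simp add: autocorr_eq[abs_def])
  have inner: "(LINT x|lborel. ?P s x * ?e x) = f s * ?e s * cnj (fourier f \<omega>)" for s
  proof -
    have "?P s x * ?e x = f s * ?e s * cnj (f (s - x) * ?e (s - x))" for x
    proof -
      have "?e x = ?e s * cnj (?e (s - x))"
        by (simp add: inner_diff_right flip: cis2pi_add)
      then show ?thesis
        by (simp only: complex_cnj_mult mult_ac)
    qed
    then have "(LINT x|lborel. ?P s x * ?e x) = (LINT x|lborel. f s * ?e s * cnj (f (s - x) * ?e (s - x)))"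
      by (rule Bochner_Integration.integral_cong[OF refl])
    also have "\<dots> = (LINT y|lborel. f s * ?e s * cnj (f y * ?e y))"
      by (rule lborel_integral_reflect_shift[of "\<lambda>y. f s * ?e s * cnj (f y * ?e y)"]) measurable
    finally show ?thesis
      by (simp only: fourier_def integral_mult_right_zero Bochner_Integration.integral_cnj)
  qed
  have "integrable (lborel \<Otimes>\<^sub>M lborel) (\<lambda>(s, x). ?P s x * ?e x)"
    by (rule Bochner_Integration.integrable_bound[OF P_integrable]) (auto simp: norm_mult)
  then have "(LINT x|lborel. LINT s|lborel. ?P s x * ?e x) = (LINT s|lborel. LINT x|lborel. ?P s x * ?e x)"
    by (rule lborel_pair.Fubini_integral)
  also have "\<dots> = fourier f \<omega> * cnj (fourier f \<omega>)"
    by (simp only: inner integral_mult_left_zero) (simp only: fourier_def)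
  finally show "fourier (autocorr f) \<omega> = of_real ((cmod (fourier f \<omega>))\<^sup>2)"
    by (simp add: fourier_def autocorr_eq flip: complex_norm_square)
qed

lemma integral_gaussian_fourier_square:
  fixes f :: "'d::finite sig"
  assumes f_integrable: "integrable lborel f" and "\<epsilon> > 0"
  shows "of_real (LINT \<omega>|lborel. gaussian (\<epsilon> *\<^sub>R \<omega>) * (cmod (fourier f \<omega>))\<^sup>2)
    = (LINT u|lborel. of_real (gaussian u) * autocorr f (\<epsilon> *\<^sub>R u))"
proof -
  have [measurable]: "f \<in> borel_measurable borel" using f_integrable by auto
  let ?G = "\<lambda>x::'d rvec. complex_of_real (gaussian (\<epsilon> *\<^sub>R x))"
  have "of_real (LINT \<omega>|lborel. gaussian (\<epsilon> *\<^sub>R \<omega>) * (cmod (fourier f \<omega>))\<^sup>2)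
      = (LINT \<omega>|lborel. fourier (autocorr f) \<omega> * ?G \<omega>)"
    unfolding fourier_autocorr[OF f_integrable] integral_complex_of_real[symmetric]
    by (simp only: of_real_mult mult.commute)
  also have "\<dots> = (LINT x|lborel. autocorr f x * fourier ?G x)"
    using \<open>\<epsilon> > 0\<close>
    by (intro integral_fourier_mult integrable_autocorr f_integrable integrable_of_real
        integrable_gaussian_scaled) simp
  also have "\<dots> = \<epsilon> ^ CARD('d) *\<^sub>R (LINT u|lborel. autocorr f (\<epsilon> *\<^sub>R u) * fourier ?G (\<epsilon> *\<^sub>R u))"
    using \<open>\<epsilon> > 0\<close> by (subst lborel_integral_affine[where c = \<epsilon> and t = 0]) auto
  also have "\<dots> = (LINT u|lborel. of_real (gaussian u) * autocorr f (\<epsilon> *\<^sub>R u))"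
  proof -
    have "\<epsilon> ^ CARD('d) *\<^sub>R fourier ?G (\<epsilon> *\<^sub>R u) = of_real (gaussian u)" for u
      using \<open>\<epsilon> > 0\<close> by (subst fourier_scale) (auto simp: fourier_gaussian)
    then show ?thesis
      by (simp add: mult.commute flip: integral_scaleR_right mult_scaleR_right)
  qed
  finally show ?thesis .
qed

lemma integrable_gaussian_fourier_square:
  fixes f :: "'a::euclidean_space \<Rightarrow> complex"
  assumes "integrable lborel f" and "\<epsilon> > 0"
  shows "integrable lborel (\<lambda>\<omega>. gaussian (\<epsilon> *\<^sub>R \<omega>) * (cmod (fourier f \<omega>))\<^sup>2)"
proof (rule Bochner_Integration.integrable_bound)
  have [measurable]: "f \<in> borel_measurable borel" using assms(1) by auto
  show "integrable lborel (\<lambda>\<omega>::'a. gaussian (\<epsilon> *\<^sub>R \<omega>) * (LINT t|lborel. cmod (f t))\<^sup>2)"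
    using \<open>\<epsilon> > 0\<close> by (intro integrable_mult_left integrable_gaussian_scaled) simp
  show "AE \<omega> in lborel. norm (gaussian (\<epsilon> *\<^sub>R \<omega>) * (cmod (fourier f \<omega>))\<^sup>2)
      \<le> norm (gaussian (\<epsilon> *\<^sub>R \<omega>) * (LINT t|lborel. cmod (f t))\<^sup>2)"
    using norm_fourier_le[of f] by (auto simp: abs_mult intro!: mult_left_mono power_mono)
  show "(\<lambda>\<omega>. gaussian (\<epsilon> *\<^sub>R \<omega>) * (cmod (fourier f \<omega>))\<^sup>2) \<in> borel_measurable lborel"
    by measurable
qed

theorem
  fixes f :: "'d::finite sig"
  assumes L2_f: "L2 f" and f_integrable: "integrable lborel f"
  shows L2_fourier: "L2 (fourier f)" and Plancherel: "l2norm (fourier f) = l2norm f"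
proof -
  note [measurable] = L2_measurable[OF L2_f]
  define \<epsilon> where "\<epsilon> n = 1 / real (Suc n)" for n
  have \<epsilon>: "\<epsilon> n > 0" "\<epsilon> \<longlonglongrightarrow> 0" "m \<le> n \<Longrightarrow> \<epsilon> n \<le> \<epsilon> m" for m n
    unfolding \<epsilon>_def using LIMSEQ_Suc[OF lim_1_over_n[where 'a = real]] by (auto simp: field_simps)
  define W where "W n \<omega> = gaussian (\<epsilon> n *\<^sub>R \<omega>) * (cmod (fourier f \<omega>))\<^sup>2" for n \<omega>
  have W: "integrable lborel (W n)" "0 \<le> W n \<omega>" for n \<omega>
    unfolding W_def using integrable_gaussian_fourier_square[OF f_integrable \<epsilon>(1)]
    by (simp_all add: less_imp_le)
  have [measurable]: "W n \<in> borel_measurable borel" for n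
    using W(1) by auto
  have W_mono: "incseq (\<lambda>n \<omega>. ennreal (W n \<omega>))"
    unfolding W_def using \<epsilon>
    by (intro monoI le_funI ennreal_leI mult_right_mono gaussian_scaleR_le) (auto simp: less_imp_le)
  have W_lim: "(\<lambda>n. W n \<omega>) \<longlonglongrightarrow> (cmod (fourier f \<omega>))\<^sup>2" for \<omega>
    using tendsto_mult[OF gaussian_scaleR_tendsto_1[OF \<epsilon>(2)] tendsto_const] by (simp add: W_def)
  have "(\<lambda>n. of_real (LINT \<omega>|lborel. W n \<omega>)) \<longlonglongrightarrow> autocorr f 0"
    unfolding W_def integral_gaussian_fourier_square[OF f_integrable \<epsilon>(1)]
    by (rule gaussian_approximate_identity[OF _ norm_autocorr_le[OF L2_f] isCont_autocorr_0[OF L2_f] \<epsilon>(2)])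
      measurable
  then have "(\<lambda>n. LINT \<omega>|lborel. W n \<omega>) \<longlonglongrightarrow> (l2norm f)\<^sup>2"
    by (simp only: autocorr_0 tendsto_of_real_iff)
  then have "(\<lambda>n. \<integral>\<^sup>+\<omega>. ennreal (W n \<omega>) \<partial>lborel) \<longlonglongrightarrow> ennreal ((l2norm f)\<^sup>2)"
    by (simp add: nn_integral_eq_integral W)
  moreover have "(\<lambda>n. \<integral>\<^sup>+\<omega>. ennreal (W n \<omega>) \<partial>lborel) \<longlonglongrightarrow> (\<integral>\<^sup>+\<omega>. ennreal ((cmod (fourier f \<omega>))\<^sup>2) \<partial>lborel)"
    by (rule nn_integral_LIMSEQ[OF W_mono]) (auto intro: W_lim)
  ultimately have energy: "(\<integral>\<^sup>+\<omega>. ennreal ((cmod (fourier f \<omega>))\<^sup>2) \<partial>lborel) = ennreal ((l2norm f)\<^sup>2)"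
    by (rule LIMSEQ_unique[rotated])
  then show L2: "L2 (fourier f)"
    by (simp add: L2_iff_nn_integral)
  from energy have "(l2norm (fourier f))\<^sup>2 = (l2norm f)\<^sup>2"
    by (simp add: ennreal_l2norm_square[OF L2, symmetric])
  then show "l2norm (fourier f) = l2norm f"
    by simp
qed

lemma Plancherel_limit:
  fixes f F :: "'d::finite sig"
  assumes f: "L2 f" "\<And>n. L2 (h n)" "\<And>n. integrable lborel (h n)" and L2_F: "L2 F"
    and lim: "(\<lambda>n. l2norm (\<lambda>t. f t - h n t)) \<longlonglongrightarrow> 0"
      "(\<lambda>n. l2norm (\<lambda>\<omega>. F \<omega> - fourier (h n) \<omega>)) \<longlonglongrightarrow> 0"
  shows "l2norm F = l2norm f"
proof -
  have "(\<lambda>n. l2norm (h n)) \<longlonglongrightarrow> l2norm F"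
    using l2norm_tendsto[OF L2_F L2_fourier[OF f(2,3)] lim(2)] by (simp add: Plancherel f)
  then show ?thesis
    using l2norm_tendsto[OF f(1,2) lim(1)] by (rule LIMSEQ_unique)
qed

section \<open>Unfolding over a fundamental domain\<close>

lemma nn_integral_count_space_eq_infsum:
  fixes f :: "'a \<Rightarrow> ennreal"
  assumes "countable I"
  shows "(\<integral>\<^sup>+i. f i \<partial>count_space I) = infsum f I"
proof (cases "finite I")
  case True
  then show ?thesis by (simp add: nn_integral_count_space_finite)
next
  case False
  let ?b = "from_nat_into I"
  have b_bij: "bij_betw ?b UNIV I"
    using assms False by (rule bij_betw_from_nat_into)
  have "((\<lambda>n. f (?b n)) has_sum infsum f I) UNIV"
    unfolding infsum_reindex_bij_betw[OF b_bij, symmetric]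
    by (intro has_sum_infsum nonneg_summable_on_complete) simp
  then have "(\<Sum>n. f (?b n)) = infsum f I"
    by (intro sums_unique[symmetric] has_sum_imp_sums)
  then show ?thesis
    using nn_integral_bij_count_space[OF b_bij, of f] by (simp add: nn_integral_count_space_nat)
qed

locale fundamental_domain =
  fixes \<Gamma> D :: "'a::euclidean_space set"
  assumes countable_translations: "countable \<Gamma>"
    and uminus_translations: "\<gamma> \<in> \<Gamma> \<Longrightarrow> - \<gamma> \<in> \<Gamma>"
    and domain_borel [measurable]: "D \<in> sets borel"
    and domain_bounded: "bounded D"
    and unique_representative: "\<exists>!\<gamma>. \<gamma> \<in> \<Gamma> \<and> t - \<gamma> \<in> D"
begin

lemma nn_integral_indicator_diff: "(\<integral>\<^sup>+\<gamma>. indicator D (t - \<gamma>) \<partial>count_space \<Gamma>) = 1"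
  and nn_integral_indicator_add: "(\<integral>\<^sup>+\<gamma>. indicator D (t + \<gamma>) \<partial>count_space \<Gamma>) = 1"
proof -
  obtain \<gamma>\<^sub>0 where \<gamma>\<^sub>0: "\<gamma>\<^sub>0 \<in> \<Gamma>" "t - \<gamma>\<^sub>0 \<in> D" and unique: "\<And>\<gamma>. \<gamma> \<in> \<Gamma> \<Longrightarrow> t - \<gamma> \<in> D \<Longrightarrow> \<gamma> = \<gamma>\<^sub>0"
    using unique_representative[of t] by auto
  have minus: "t - \<gamma> \<in> D \<longleftrightarrow> \<gamma> = \<gamma>\<^sub>0" if "\<gamma> \<in> \<Gamma>" for \<gamma>
    using \<gamma>\<^sub>0(2) unique[OF that] by blast
  then have "(\<integral>\<^sup>+\<gamma>. indicator D (t - \<gamma>) \<partial>count_space \<Gamma>) = (\<integral>\<^sup>+\<gamma>. indicator {\<gamma>\<^sub>0} \<gamma> \<partial>count_space \<Gamma>)"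
    by (intro nn_integral_cong) (simp add: indicator_def)
  then show "(\<integral>\<^sup>+\<gamma>. indicator D (t - \<gamma>) \<partial>count_space \<Gamma>) = 1"
    using \<gamma>\<^sub>0(1) by simp
  have "t + \<gamma> \<in> D \<longleftrightarrow> \<gamma> = - \<gamma>\<^sub>0" if "\<gamma> \<in> \<Gamma>" for \<gamma>
    using minus[OF uminus_translations[OF that]] by simp (metis minus_minus)
  then have "(\<integral>\<^sup>+\<gamma>. indicator D (t + \<gamma>) \<partial>count_space \<Gamma>) = (\<integral>\<^sup>+\<gamma>. indicator {- \<gamma>\<^sub>0} \<gamma> \<partial>count_space \<Gamma>)"
    by (intro nn_integral_cong) (simp add: indicator_def)
  then show "(\<integral>\<^sup>+\<gamma>. indicator D (t + \<gamma>) \<partial>count_space \<Gamma>) = 1"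
    using uminus_translations[OF \<gamma>\<^sub>0(1)] by simp
qed

lemma nn_integral_unfold:
  assumes [measurable]: "f \<in> borel_measurable borel"
  shows "(\<integral>\<^sup>+t. f t \<partial>lborel) = (\<integral>\<^sup>+t\<in>D. (\<integral>\<^sup>+\<gamma>. f (t + \<gamma>) \<partial>count_space \<Gamma>) \<partial>lborel)"
proof -
  have "(\<integral>\<^sup>+t. f t \<partial>lborel) = (\<integral>\<^sup>+t. \<integral>\<^sup>+\<gamma>. f t * indicator D (t - \<gamma>) \<partial>count_space \<Gamma> \<partial>lborel)"
    by (simp add: nn_integral_cmult nn_integral_indicator_diff)
  also have "\<dots> = (\<integral>\<^sup>+\<gamma>. \<integral>\<^sup>+t. f t * indicator D (t - \<gamma>) \<partial>lborel \<partial>count_space \<Gamma>)"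
    by (intro nn_integral_count_space_nn_integral countable_translations) measurable
  also have "\<dots> = (\<integral>\<^sup>+\<gamma>. \<integral>\<^sup>+t. f (t + \<gamma>) * indicator D t \<partial>lborel \<partial>count_space \<Gamma>)"
  proof (rule nn_integral_cong)
    fix \<gamma>
    have "(\<integral>\<^sup>+t. f (t + \<gamma>) * indicator D (t + \<gamma> - \<gamma>) \<partial>lborel) = (\<integral>\<^sup>+t. f t * indicator D (t - \<gamma>) \<partial>lborel)"
      by (rule nn_integral_lborel_shift) measurable
    then show "(\<integral>\<^sup>+t. f t * indicator D (t - \<gamma>) \<partial>lborel) = (\<integral>\<^sup>+t. f (t + \<gamma>) * indicator D t \<partial>lborel)"
      by simp
  qed
  also have "\<dots> = (\<integral>\<^sup>+t. \<integral>\<^sup>+\<gamma>. f (t + \<gamma>) * indicator D t \<partial>count_space \<Gamma> \<partial>lborel)"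
    by (intro nn_integral_count_space_nn_integral[symmetric] countable_translations) measurable
  finally show ?thesis
    by (simp add: nn_integral_multc)
qed

lemma nn_integral_periodic_shift:
  assumes [measurable]: "f \<in> borel_measurable borel" and periodic: "\<And>\<gamma> t. \<gamma> \<in> \<Gamma> \<Longrightarrow> f (t + \<gamma>) = f t"
  shows "(\<integral>\<^sup>+t\<in>D. f (t + a) \<partial>lborel) = (\<integral>\<^sup>+t\<in>D. f t \<partial>lborel)"
proof -
  have unfolded: "(\<integral>\<^sup>+\<gamma>. f (t + \<gamma>) * indicator D (t + \<gamma> - a) \<partial>count_space \<Gamma>) = f t" for t
  proof -
    have "(\<integral>\<^sup>+\<gamma>. f (t + \<gamma>) * indicator D (t + \<gamma> - a) \<partial>count_space \<Gamma>)
        = (\<integral>\<^sup>+\<gamma>. f t * indicator D (t - a + \<gamma>) \<partial>count_space \<Gamma>)"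
      by (intro nn_integral_cong) (simp add: periodic diff_add_eq)
    then show ?thesis
      by (simp add: nn_integral_cmult nn_integral_indicator_add)
  qed
  have "(\<integral>\<^sup>+t\<in>D. f (t + a) \<partial>lborel) = (\<integral>\<^sup>+t. f t * indicator D (t - a) \<partial>lborel)"
    using nn_integral_lborel_shift[of "\<lambda>t. f t * indicator D (t - a)" a] by simp
  also have "\<dots> = (\<integral>\<^sup>+t\<in>D. (\<integral>\<^sup>+\<gamma>. f (t + \<gamma>) * indicator D (t + \<gamma> - a) \<partial>count_space \<Gamma>) \<partial>lborel)"
    by (rule nn_integral_unfold) measurable
  also have "\<dots> = (\<integral>\<^sup>+t\<in>D. f t \<partial>lborel)"
    by (simp only: unfolded)
  finally show ?thesis .
qed

lemma integral_periodic_shift: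
  fixes f :: "'a \<Rightarrow> 'b::{banach, second_countable_topology}"
  assumes [measurable]: "f \<in> borel_measurable borel" and periodic: "\<And>\<gamma> t. \<gamma> \<in> \<Gamma> \<Longrightarrow> f (t + \<gamma>) = f t"
  shows "(LINT t:D|lborel. f (t + a)) = (LINT t:D|lborel. f t)"
proof -
  define M where "M = density lborel (\<lambda>t. ennreal (indicator D t))"
  have [simp, measurable_cong]: "sets M = sets borel"
    by (simp add: M_def)
  have integral_M: "(LINT t|M. h t) = (LINT t:D|lborel. h t)"
    if "h \<in> borel_measurable borel" for h :: "'a \<Rightarrow> 'b"
    unfolding M_def set_lebesgue_integral_def using that by (subst integral_density) auto
  have "distr M borel (\<lambda>t. f (t + a)) = distr M borel f"
  proof (rule measure_eqI)
    fix B assume "B \<in> sets (distr M borel (\<lambda>t. f (t + a)))"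
    then have [measurable]: "B \<in> sets borel" by simp
    have "emeasure (distr M borel h) B = (\<integral>\<^sup>+t\<in>D. indicator B (h t) \<partial>lborel)"
      if [measurable]: "h \<in> borel_measurable borel" for h
      by (subst nn_integral_indicator[symmetric], measurable, subst nn_integral_distr, measurable)
        (simp add: M_def nn_integral_density mult.commute ennreal_indicator)
    then show "emeasure (distr M borel (\<lambda>t. f (t + a))) B = emeasure (distr M borel f) B"
      using nn_integral_periodic_shift[of "\<lambda>t. indicator B (f t)" a] by (simp add: periodic)
  qed simp
  then have "(LINT y|distr M borel (\<lambda>t. f (t + a)). y) = (LINT y|distr M borel f. y)"
    by simp
  then show ?thesis
    by (simp add: integral_distr integral_M)
qed

lemma set_integrable_bounded:
  fixes f :: "'a \<Rightarrow> 'b::{banach, second_countable_topology}"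
  assumes [measurable]: "f \<in> borel_measurable borel" and bound: "\<And>t. norm (f t) \<le> B"
  shows "set_integrable lborel D f"
  unfolding set_integrable_def
  by (rule integrableI_bounded_set_indicator[of _ _ _ B])
    (use emeasure_bounded_finite[OF domain_bounded] bound in auto)

text \<open>A nontrivial character changes sign under a translation by half a period.\<close>

lemma integral_cis2pi_eq_0:
  assumes "v \<noteq> 0" and pairing_int: "\<And>\<gamma>. \<gamma> \<in> \<Gamma> \<Longrightarrow> v \<bullet> \<gamma> \<in> \<int>"
  shows "(LINT t:D|lborel. cis2pi (v \<bullet> t)) = 0"
proof -
  define a where "a = (1 / (2 * (v \<bullet> v))) *\<^sub>R v"
  have "v \<bullet> a = 1 / 2"
    using \<open>v \<noteq> 0\<close> by (simp add: a_def)
  then have "cis2pi (v \<bullet> a) = - 1"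
    by (simp only: cis2pi_half)
  then have "cis2pi (v \<bullet> (t + a)) = - cis2pi (v \<bullet> t)" for t
    by (simp add: inner_add_right cis2pi_add)
  moreover have "(LINT t:D|lborel. cis2pi (v \<bullet> (t + a))) = (LINT t:D|lborel. cis2pi (v \<bullet> t))"
    by (rule integral_periodic_shift) (auto simp: inner_add_right cis2pi_add cis2pi_Ints pairing_int)
  ultimately show ?thesis
    by (simp add: set_lebesgue_integral_def)
qed

end

section \<open>The Bessel inequality for translates\<close>

definition trig_poly :: "'a::euclidean_space set \<Rightarrow> ('a \<Rightarrow> complex) \<Rightarrow> 'a \<Rightarrow> complex" where
  "trig_poly G c \<omega> = (\<Sum>m\<in>G. c m * cis2pi (- (\<omega> \<bullet> m)))"

lemma trig_poly_measurable [measurable]: "trig_poly G c \<in> borel_measurable borel"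
  unfolding trig_poly_def[abs_def] by measurable

lemma norm_trig_poly_le: "cmod (trig_poly G c \<omega>) \<le> (\<Sum>m\<in>G. cmod (c m))"
  unfolding trig_poly_def by (rule order_trans[OF norm_sum]) (simp add: norm_mult)

lemma trig_poly_square:
  "of_real ((cmod (trig_poly G c \<omega>))\<^sup>2)
    = (\<Sum>m\<in>G. \<Sum>n\<in>G. c m * cnj (c n) * cis2pi ((n - m) \<bullet> \<omega>))"
proof -
  have "c m * cis2pi (- (\<omega> \<bullet> m)) * cnj (c n * cis2pi (- (\<omega> \<bullet> n)))
      = c m * cnj (c n) * cis2pi ((n - m) \<bullet> \<omega>)" for m n
  proof -
    have "cis2pi ((n - m) \<bullet> \<omega>) = cis2pi (- (\<omega> \<bullet> m)) * cis2pi (\<omega> \<bullet> n)"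
      by (simp add: inner_diff_left inner_commute[of \<omega>] flip: cis2pi_add)
    then show ?thesis by simp
  qed
  then show ?thesis
    by (simp only: complex_norm_square trig_poly_def cnj_sum sum_product)
qed

lemma trig_poly_periodic:
  assumes "\<And>m. m \<in> G \<Longrightarrow> m \<bullet> \<gamma> \<in> \<int>"
  shows "trig_poly G c (\<omega> + \<gamma>) = trig_poly G c \<omega>"
  unfolding trig_poly_def
proof (rule sum.cong[OF refl])
  fix m assume "m \<in> G"
  have "cis2pi (- ((\<omega> + \<gamma>) \<bullet> m)) = cis2pi (- (\<omega> \<bullet> m)) * cis2pi (- (\<gamma> \<bullet> m))"
    by (simp add: inner_add_left flip: cis2pi_add)
  also have "cis2pi (- (\<gamma> \<bullet> m)) = 1"
    using assms[OF \<open>m \<in> G\<close>] by (intro cis2pi_Ints) (simp add: inner_commute)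
  finally show "c m * cis2pi (- ((\<omega> + \<gamma>) \<bullet> m)) = c m * cis2pi (- (\<omega> \<bullet> m))"
    by simp
qed

context fundamental_domain
begin

lemma trig_poly_Parseval:
  assumes "finite G" and pairing_int: "\<And>m \<gamma>. m \<in> G \<Longrightarrow> \<gamma> \<in> \<Gamma> \<Longrightarrow> m \<bullet> \<gamma> \<in> \<int>"
  shows "(LINT t:D|lborel. (cmod (trig_poly G c t))\<^sup>2) = measure lborel D * (\<Sum>m\<in>G. (cmod (c m))\<^sup>2)"
proof -
  let ?e = "\<lambda>m n t. c m * cnj (c n) * cis2pi ((n - m) \<bullet> t)"
  have e_integrable: "set_integrable lborel D (?e m n)" for m n
    by (rule set_integrable_bounded[where B = "cmod (c m) * cmod (c n)"]) (auto simp: norm_mult)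
  have e_integral: "(LINT t:D|lborel. ?e m n t)
      = (if n = m then of_real (measure lborel D * (cmod (c m))\<^sup>2) else 0)"
    if "m \<in> G" "n \<in> G" for m n
  proof (cases "n = m")
    case True
    then show ?thesis
      by (simp add: set_lebesgue_integral_def complex_norm_square mult.commute scaleR_conv_of_real
          flip: of_real_power)
  next
    case False
    then have "(LINT t:D|lborel. cis2pi ((n - m) \<bullet> t)) = 0"
      using pairing_int that by (intro integral_cis2pi_eq_0) (auto simp: inner_diff_left)
    then show ?thesis
      using False by (simp add: set_integral_mult_right)
  qed
  have "of_real (LINT t:D|lborel. (cmod (trig_poly G c t))\<^sup>2)
      = (LINT t:D|lborel. of_real ((cmod (trig_poly G c t))\<^sup>2) :: complex)"
    by (rule set_integral_complex_of_real[symmetric])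
  also have "\<dots> = (\<Sum>m\<in>G. \<Sum>n\<in>G. LINT t:D|lborel. ?e m n t)"
    using e_integrable unfolding trig_poly_square set_lebesgue_integral_def set_integrable_def scaleR_sum_right
    by (simp add: Bochner_Integration.integral_sum)
  also have "\<dots> = (\<Sum>m\<in>G. \<Sum>n\<in>G. if n = m then of_real (measure lborel D * (cmod (c m))\<^sup>2) else 0)"
    by (intro sum.cong refl e_integral)
  also have "\<dots> = of_real (measure lborel D * (\<Sum>m\<in>G. (cmod (c m))\<^sup>2))"
    using \<open>finite G\<close> by (simp add: sum_distrib_left)
  finally show ?thesis
    by (simp only: of_real_eq_iff)
qed

lemma nn_integral_trig_poly_mult:
  assumes pairing_int: "\<And>m \<gamma>. m \<in> G \<Longrightarrow> \<gamma> \<in> \<Gamma> \<Longrightarrow> m \<bullet> \<gamma> \<in> \<int>"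
    and [measurable]: "H \<in> borel_measurable borel"
  shows "(\<integral>\<^sup>+t. ennreal ((cmod (trig_poly G c t * H t))\<^sup>2) \<partial>lborel)
    = (\<integral>\<^sup>+t\<in>D. (ennreal ((cmod (trig_poly G c t))\<^sup>2) *
        (\<Sum>\<^sub>\<infinity>\<gamma>\<in>\<Gamma>. ennreal ((cmod (H (t + \<gamma>)))\<^sup>2))) \<partial>lborel)"
proof -
  let ?P = "\<lambda>t. ennreal ((cmod (trig_poly G c t))\<^sup>2)" and ?H = "\<lambda>t. ennreal ((cmod (H t))\<^sup>2)"
  have "(\<integral>\<^sup>+\<gamma>. ennreal ((cmod (trig_poly G c (t + \<gamma>) * H (t + \<gamma>)))\<^sup>2) \<partial>count_space \<Gamma>)
      = ?P t * (\<Sum>\<^sub>\<infinity>\<gamma>\<in>\<Gamma>. ?H (t + \<gamma>))" for t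
  proof -
    have "(\<integral>\<^sup>+\<gamma>. ennreal ((cmod (trig_poly G c (t + \<gamma>) * H (t + \<gamma>)))\<^sup>2) \<partial>count_space \<Gamma>)
        = (\<integral>\<^sup>+\<gamma>. ?P t * ?H (t + \<gamma>) \<partial>count_space \<Gamma>)"
      by (intro nn_integral_cong)
        (simp add: trig_poly_periodic pairing_int norm_mult power_mult_distrib ennreal_mult)
    also have "\<dots> = ?P t * (\<integral>\<^sup>+\<gamma>. ?H (t + \<gamma>) \<partial>count_space \<Gamma>)"
      by (rule nn_integral_cmult) simp
    finally show ?thesis
      by (simp only: nn_integral_count_space_eq_infsum[OF countable_translations])
  qed
  then show ?thesis
    by (subst nn_integral_unfold) auto
qed

lemma nn_integral_trig_poly_mult_le:
  assumes G_finite: "finite G" and pairing_int: "\<And>m \<gamma>. m \<in> G \<Longrightarrow> \<gamma> \<in> \<Gamma> \<Longrightarrow> m \<bullet> \<gamma> \<in> \<int>"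
    and "H \<in> borel_measurable borel"
    and bound: "AE t in lborel. t \<in> D \<longrightarrow> (\<Sum>\<^sub>\<infinity>\<gamma>\<in>\<Gamma>. ennreal ((cmod (H (t + \<gamma>)))\<^sup>2)) \<le> ennreal C"
  shows "(\<integral>\<^sup>+t. ennreal ((cmod (trig_poly G c t * H t))\<^sup>2) \<partial>lborel)
    \<le> ennreal C * ennreal (measure lborel D * (\<Sum>m\<in>G. (cmod (c m))\<^sup>2))"
proof -
  let ?P = "\<lambda>t. ennreal ((cmod (trig_poly G c t))\<^sup>2)"
  have "(\<integral>\<^sup>+t. ennreal ((cmod (trig_poly G c t * H t))\<^sup>2) \<partial>lborel)
      = (\<integral>\<^sup>+t\<in>D. (?P t * (\<Sum>\<^sub>\<infinity>\<gamma>\<in>\<Gamma>. ennreal ((cmod (H (t + \<gamma>)))\<^sup>2))) \<partial>lborel)"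
    using pairing_int by (intro nn_integral_trig_poly_mult assms(3))
  also have "\<dots> \<le> (\<integral>\<^sup>+t. ennreal C * (?P t * indicator D t) \<partial>lborel)"
  proof (rule nn_integral_mono_AE, use bound in eventually_elim)
    case (elim t)
    then show ?case
      by (cases "t \<in> D") (auto simp: mult.commute[of "ennreal C"] intro: mult_left_mono)
  qed
  also have "\<dots> = ennreal C * (\<integral>\<^sup>+t\<in>D. ?P t \<partial>lborel)"
    by (rule nn_integral_cmult) measurable
  also have "(\<integral>\<^sup>+t\<in>D. ?P t \<partial>lborel) = ennreal (LINT t:D|lborel. (cmod (trig_poly G c t))\<^sup>2)"
  proof -
    have "set_integrable lborel D (\<lambda>t. (cmod (trig_poly G c t))\<^sup>2)"
      by (rule set_integrable_bounded) (auto intro!: power_mono norm_trig_poly_le)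
    then have "ennreal (LINT t:D|lborel. (cmod (trig_poly G c t))\<^sup>2)
        = (\<integral>\<^sup>+t. ennreal (indicator D t *\<^sub>R (cmod (trig_poly G c t))\<^sup>2) \<partial>lborel)"
      unfolding set_lebesgue_integral_def set_integrable_def
      by (intro nn_integral_eq_integral[symmetric]) auto
    also have "\<dots> = (\<integral>\<^sup>+t\<in>D. ?P t \<partial>lborel)"
      by (intro nn_integral_cong) (simp add: indicator_def)
    finally show ?thesis ..
  qed
  also have "\<dots> = ennreal (measure lborel D * (\<Sum>m\<in>G. (cmod (c m))\<^sup>2))"
    by (simp only: trig_poly_Parseval[OF G_finite pairing_int])
  finally show ?thesis .
qed

end

lemma L2_translates: "L2 \<psi> \<Longrightarrow> L2 (\<lambda>t. \<Sum>m\<in>G. c m * transl m \<psi> t)"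
  by (intro L2_sum L2_cmult L2_transl)

lemma l2norm_translates_le:
  assumes L2_\<psi>: "L2 \<psi>"
  shows "l2norm (\<lambda>t. \<Sum>m\<in>G. c m * transl m \<psi> t) \<le> (\<Sum>m\<in>G. cmod (c m)) * l2norm \<psi>"
proof -
  have "l2norm (\<lambda>t. \<Sum>m\<in>G. c m * transl m \<psi> t) \<le> (\<Sum>m\<in>G. l2norm (\<lambda>t. c m * transl m \<psi> t))"
    by (intro l2norm_sum_le L2_cmult L2_transl L2_\<psi>)
  then show ?thesis
    by (simp add: l2norm_cmult l2norm_transl L2_\<psi> sum_distrib_right)
qed

lemma integrable_transl: "integrable lborel f \<Longrightarrow> integrable lborel (transl m f)"
  unfolding transl_def using lborel_integrable_affine[of f 1 "-m"] by simp

lemma fourier_translates: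
  assumes f_integrable: "integrable lborel f"
  shows "fourier (\<lambda>t. \<Sum>m\<in>G. c m * transl m f t) \<omega> = trig_poly G c \<omega> * fourier f \<omega>"
proof -
  have [measurable]: "f \<in> borel_measurable borel" using f_integrable by auto
  have "fourier (transl m f) \<omega> = cis2pi (- (\<omega> \<bullet> m)) * fourier f \<omega>" for m
    unfolding transl_def by (rule fourier_shift) measurable
  then show ?thesis
    by (simp add: fourier_sum[OF integrable_transl[OF f_integrable]] trig_poly_def sum_distrib_right mult.assoc)
qed

lemma is_L2_fourier_approx:
  fixes \<psi> :: "'d::finite sig"
  assumes L2_\<psi>: "L2 \<psi>" and fourier_H: "is_L2_fourier \<psi> H"
  obtains h where "\<And>n::nat. L2 (h n)" "\<And>n. integrable lborel (h n)"
    "(\<lambda>n. l2norm (\<lambda>t. \<psi> t - h n t)) \<longlonglongrightarrow> 0" "(\<lambda>n. l2norm (\<lambda>\<omega>. H \<omega> - fourier (h n) \<omega>)) \<longlonglongrightarrow> 0"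
proof
  define X where "X n = {s :: 'd rvec. \<forall>i. \<bar>s $ i\<bar> \<le> real n}" for n
  define h where "h n t = indicator (X n) t * \<psi> t" for n t
  have "X n = cbox (\<chi> i. - real n) (\<chi> i. real n)" for n
    by (auto simp: X_def mem_box_cart abs_le_iff minus_le_iff)
  then have X: "X n \<in> sets borel" "bounded (X n)" for n
    by (simp_all add: bounded_cbox)
  show "L2 (h n)" "integrable lborel (h n)" for n
    unfolding h_def[abs_def] by (intro L2_indicator_mult integrable_indicator_mult_L2 L2_\<psi> X)+
  have exhaust: "\<forall>\<^sub>F n in sequentially. t \<in> X n" for t
  proof -
    obtain N :: nat where N: "norm t \<le> real N"
      using real_arch_simple by blast
    have "t \<in> X n" if "n \<ge> N" for n
      using N that order_trans[OF component_le_norm_cart[of t]] by (force simp: X_def)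
    then show ?thesis
      by (rule eventually_sequentiallyI)
  qed
  then show "(\<lambda>n. l2norm (\<lambda>t. \<psi> t - h n t)) \<longlonglongrightarrow> 0"
    unfolding h_def by (rule l2norm_diff_indicator_tendsto_0[OF L2_\<psi> X(1)])
  have "fourier (h n) = fourier_trunc (real n) \<psi>" for n
    by (rule ext) (simp add: fourier_def fourier_trunc_def h_def X_def exp_eq_cis2pi)
  moreover have "(\<lambda>n. l2dist H (fourier_trunc (real n) \<psi>)) \<longlonglongrightarrow> 0"
    using fourier_H filterlim_real_sequentially unfolding is_L2_fourier_def by (auto intro: filterlim_compose)
  ultimately show "(\<lambda>n. l2norm (\<lambda>\<omega>. H \<omega> - fourier (h n) \<omega>)) \<longlonglongrightarrow> 0"
    by (simp add: l2dist_eq_l2norm)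
qed

lemma l2norm_translates:
  fixes \<psi> :: "'d::finite sig"
  assumes L2_\<psi>: "L2 \<psi>" and fourier_H: "is_L2_fourier \<psi> H"
  shows "l2norm (\<lambda>\<omega>. trig_poly G c \<omega> * H \<omega>) = l2norm (\<lambda>t. \<Sum>m\<in>G. c m * transl m \<psi> t)"
proof -
  obtain h where h: "\<And>n. L2 (h n)" "\<And>n. integrable lborel (h n)"
    and lim: "(\<lambda>n. l2norm (\<lambda>t. \<psi> t - h n t)) \<longlonglongrightarrow> 0" "(\<lambda>n. l2norm (\<lambda>\<omega>. H \<omega> - fourier (h n) \<omega>)) \<longlonglongrightarrow> 0"
    using is_L2_fourier_approx[OF L2_\<psi> fourier_H] by blast
  have L2_H: "L2 H"
    using fourier_H by (simp add: is_L2_fourier_def)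
  let ?T = "\<lambda>f t. \<Sum>m\<in>G. c m * transl m f t" and ?P = "trig_poly G c" and ?K = "\<Sum>m\<in>G. cmod (c m)"
  have bound_T: "l2norm (\<lambda>t. ?T \<psi> t - ?T (h n) t) \<le> ?K * l2norm (\<lambda>t. \<psi> t - h n t)" for n
  proof -
    have "(\<lambda>t. ?T \<psi> t - ?T (h n) t) = ?T (\<lambda>t. \<psi> t - h n t)"
      by (simp add: transl_def right_diff_distrib sum_subtractf)
    then show ?thesis
      using l2norm_translates_le[OF L2_diff[OF L2_\<psi> h(1)]] by simp
  qed
  have bound_P: "l2norm (\<lambda>\<omega>. ?P \<omega> * H \<omega> - fourier (?T (h n)) \<omega>) \<le> ?K * l2norm (\<lambda>\<omega>. H \<omega> - fourier (h n) \<omega>)" for n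
    using l2norm_bounded_mult_le[OF L2_diff[OF L2_H L2_fourier[OF h(1,2)]]
        trig_poly_measurable norm_trig_poly_le]
    by (simp add: fourier_translates[OF h(2)] right_diff_distrib)
  show ?thesis
  proof (rule Plancherel_limit[where h = "\<lambda>n. ?T (h n)"])
    show "L2 (\<lambda>\<omega>. ?P \<omega> * H \<omega>)"
      by (rule L2_bounded_mult[OF L2_H trig_poly_measurable norm_trig_poly_le])
    show "integrable lborel (?T (h n))" for n
      by (intro Bochner_Integration.integrable_sum integrable_mult_right integrable_transl h)
    show "(\<lambda>n. l2norm (\<lambda>t. ?T \<psi> t - ?T (h n) t)) \<longlonglongrightarrow> 0"
      by (rule Lim_null_comparison[OF always_eventually tendsto_mult_right_zero[OF lim(1)]])
        (use bound_T in auto)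
    show "(\<lambda>n. l2norm (\<lambda>\<omega>. ?P \<omega> * H \<omega> - fourier (?T (h n)) \<omega>)) \<longlonglongrightarrow> 0"
      by (rule Lim_null_comparison[OF always_eventually tendsto_mult_right_zero[OF lim(2)]])
        (use bound_P in auto)
  qed (intro L2_translates L2_\<psi> h)+
qed

lemma Bessel_translates:
  fixes \<Gamma> D :: "'d::finite rvec set"
  assumes domain: "fundamental_domain \<Gamma> D" and L2_\<psi>: "L2 \<psi>" "is_L2_fourier \<psi> H" and "0 \<le> C"
    and bound: "AE t in lborel. t \<in> D \<longrightarrow> periodization \<Gamma> H t \<le> ennreal C"
    and G_finite: "finite G" and pairing_int: "\<And>m \<gamma>. m \<in> G \<Longrightarrow> \<gamma> \<in> \<Gamma> \<Longrightarrow> m \<bullet> \<gamma> \<in> \<int>"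
  shows "(l2norm (\<lambda>t. \<Sum>m\<in>G. c m * transl m \<psi> t))\<^sup>2 \<le> C * measure lborel D * (\<Sum>m\<in>G. (cmod (c m))\<^sup>2)"
proof -
  have L2_H: "L2 H"
    using L2_\<psi>(2) by (simp add: is_L2_fourier_def)
  have L2_PH: "L2 (\<lambda>\<omega>. trig_poly G c \<omega> * H \<omega>)"
    by (rule L2_bounded_mult[OF L2_H trig_poly_measurable norm_trig_poly_le])
  have "ennreal ((l2norm (\<lambda>t. \<Sum>m\<in>G. c m * transl m \<psi> t))\<^sup>2)
      = (\<integral>\<^sup>+t. ennreal ((cmod (trig_poly G c t * H t))\<^sup>2) \<partial>lborel)"
    by (simp add: ennreal_l2norm_square[OF L2_PH] flip: l2norm_translates[OF L2_\<psi>])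
  also have "\<dots> \<le> ennreal C * ennreal (measure lborel D * (\<Sum>m\<in>G. (cmod (c m))\<^sup>2))"
    using bound
    by (intro fundamental_domain.nn_integral_trig_poly_mult_le[OF domain G_finite
          pairing_int L2_measurable[OF L2_H]])
      (simp_all add: periodization_def)
  also have "\<dots> = ennreal (C * measure lborel D * (\<Sum>m\<in>G. (cmod (c m))\<^sup>2))"
    using \<open>0 \<le> C\<close> by (simp add: ennreal_mult' mult.assoc)
  finally show ?thesis
    using \<open>0 \<le> C\<close> by (simp add: sum_nonneg)
qed

section \<open>The dual lattice\<close>

lemma
  fixes A :: "real ^ 'd ^ 'd"
  assumes "invertible A"
  shows matrix_inv_transpose_left_inverse: "(matrix_inv (transpose A) *v v) v* A = v"
    and matrix_inv_transpose_right_inverse: "matrix_inv (transpose A) *v (v v* A) = v"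
proof -
  have "transpose A ** matrix_inv (transpose A) = mat 1 \<and> matrix_inv (transpose A) ** transpose A = mat 1"
    unfolding matrix_inv_def
    using someI_ex[OF transpose_invertible[OF assms, unfolded invertible_def]] .
  then show "(matrix_inv (transpose A) *v v) v* A = v" "matrix_inv (transpose A) *v (v v* A) = v"
    by (simp_all add: matrix_vector_mul_assoc flip: transpose_matrix_vector)
qed

lemma inner_lattice_dual_lattice:
  assumes "invertible A" "m \<in> lattice A" "l \<in> dual_lattice A"
  shows "m \<bullet> l \<in> \<int>"
proof -
  obtain v w where v: "m = A *v v" "int_vec v" and w: "l = matrix_inv (transpose A) *v w" "int_vec w"
    using assms by (auto simp: lattice_def dual_lattice_def)
  have "m \<bullet> l = (l v* A) \<bullet> v"
    by (simp only: v(1) dot_lmul_matrix inner_commute[of "A *v v"])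
  also have "\<dots> = w \<bullet> v"
    by (simp add: w(1) matrix_inv_transpose_left_inverse[OF assms(1)])
  also have "\<dots> \<in> \<int>"
    using v(2) w(2) by (auto simp: inner_vec_def int_vec_def)
  finally show ?thesis .
qed

lemma countable_dual_lattice: "countable (dual_lattice A)"
proof -
  have "\<exists>w :: int ^ 'a. v = (\<chi> i. of_int (w $ i))" if "int_vec v" for v :: "real ^ 'a"
    using that by (intro exI[of _ "\<chi> i. \<lfloor>v $ i\<rfloor>"]) (auto simp: int_vec_def vec_eq_iff)
  then have "dual_lattice A \<subseteq> range (\<lambda>w :: int ^ 'a. matrix_inv (transpose A) *v (\<chi> i. of_int (w $ i)))"
    unfolding dual_lattice_def by fast
  then show ?thesis
    by (rule countable_subset) simp
qed

text \<open>The boundary of \<^const>\<open>dual_cell\<close> is shared by neighbouring translates, so the half-open cell is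
  the one that tiles.\<close>

definition half_open_dual_cell :: "real ^ 'd ^ 'd \<Rightarrow> 'd::finite rvec set" where
  "half_open_dual_cell A = {t. \<forall>i. 0 \<le> (t v* A) $ i \<and> (t v* A) $ i < 1}"

lemma half_open_dual_cell_subset:
  assumes "invertible A"
  shows "half_open_dual_cell A \<subseteq> dual_cell A"
proof
  fix t assume "t \<in> half_open_dual_cell A"
  then show "t \<in> dual_cell A"
    unfolding dual_cell_def half_open_dual_cell_def
    by (intro CollectI exI[of _ "t v* A"]) (auto simp: matrix_inv_transpose_right_inverse[OF assms] less_imp_le)
qed

lemma bounded_dual_cell: "bounded (dual_cell A)"
proof -
  have "dual_cell A = (*v) (matrix_inv (transpose A)) ` cbox 0 (\<chi> i. 1)"
    by (auto simp: dual_cell_def mem_box_cart)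
  then show ?thesis
    by (simp add: bounded_linear_image matrix_vector_mul_bounded_linear)
qed

lemma half_open_dual_cell_borel: "half_open_dual_cell A \<in> sets borel"
proof -
  have "continuous_on UNIV (\<lambda>t. t v* A)"
    unfolding transpose_matrix_vector[symmetric]
    by (rule linear_continuous_on[OF matrix_vector_mul_bounded_linear])
  then have [measurable]: "(\<lambda>t. t v* A) \<in> borel_measurable borel"
    by (rule borel_measurable_continuous_onI)
  show ?thesis
    unfolding half_open_dual_cell_def by measurable
qed

lemma uminus_dual_lattice:
  assumes "\<gamma> \<in> dual_lattice A"
  shows "- \<gamma> \<in> dual_lattice A"
proof -
  obtain k where "\<gamma> = matrix_inv (transpose A) *v k" "int_vec k"
    using assms by (auto simp: dual_lattice_def)
  then have "- \<gamma> = matrix_inv (transpose A) *v (- k)" "int_vec (- k)"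
    by (auto simp: int_vec_def matrix_vector_mult_def vec_eq_iff sum_negf)
  then show ?thesis
    unfolding dual_lattice_def by blast
qed

lemma diff_mem_half_open_dual_cell_iff:
  assumes inv_A: "invertible A" and k_int: "int_vec k"
  shows "t - matrix_inv (transpose A) *v k \<in> half_open_dual_cell A \<longleftrightarrow> k = (\<chi> i. of_int \<lfloor>(t v* A) $ i\<rfloor>)"
proof -
  have "(t - matrix_inv (transpose A) *v k) v* A = t v* A - k"
    by (simp add: matrix_inv_transpose_left_inverse[OF inv_A] vector_matrix_mult_diff_distrib)
  moreover have "0 \<le> (t v* A) $ i - k $ i \<and> (t v* A) $ i - k $ i < 1 \<longleftrightarrow> k $ i = of_int \<lfloor>(t v* A) $ i\<rfloor>" for i
  proof -
    obtain n where "k $ i = of_int n"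
      using k_int by (auto simp: int_vec_def elim: Ints_cases)
    then show ?thesis
      using floor_eq_iff[of "(t v* A) $ i" n] by auto linarith
  qed
  ultimately show ?thesis
    by (simp add: half_open_dual_cell_def vec_eq_iff)
qed

lemma fundamental_domain_dual_lattice:
  fixes A :: "real ^ 'd ^ 'd"
  assumes inv_A: "invertible A"
  shows "fundamental_domain (dual_lattice A) (half_open_dual_cell A)"
proof
  show "bounded (half_open_dual_cell A)"
    by (rule bounded_subset[OF bounded_dual_cell half_open_dual_cell_subset[OF inv_A]])
  show "\<exists>!\<gamma>. \<gamma> \<in> dual_lattice A \<and> t - \<gamma> \<in> half_open_dual_cell A" for t
  proof
    let ?k = "\<chi> i. of_int \<lfloor>(t v* A) $ i\<rfloor>"
    have "int_vec ?k"
      by (simp add: int_vec_def)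
    then show "matrix_inv (transpose A) *v ?k \<in> dual_lattice A
        \<and> t - matrix_inv (transpose A) *v ?k \<in> half_open_dual_cell A"
      by (auto simp: diff_mem_half_open_dual_cell_iff[OF inv_A] dual_lattice_def)
    show "\<gamma> = matrix_inv (transpose A) *v ?k"
      if "\<gamma> \<in> dual_lattice A \<and> t - \<gamma> \<in> half_open_dual_cell A" for \<gamma>
      using that diff_mem_half_open_dual_cell_iff[OF inv_A, of _ t] by (auto simp: dual_lattice_def)
  qed
qed (fact countable_dual_lattice uminus_dual_lattice half_open_dual_cell_borel)+

section \<open>Unconditional convergence in L2\<close>

lemma L2_has_sum_iff_tendsto:
  "L2_has_sum F I f \<longleftrightarrow> L2 f \<and> ((\<lambda>G. l2norm (\<lambda>t. f t - (\<Sum>i\<in>G. F i t))) \<longlongrightarrow> 0) (finite_subsets_at_top I)"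
  by (simp add: L2_has_sum_def l2dist_eq_l2norm tendsto_iff eventually_finite_subsets_at_top)

lemma L2_has_sum_finite:
  assumes "finite I" "\<And>i. i \<in> I \<Longrightarrow> L2 (F i)"
  shows "L2_has_sum F I (\<lambda>t. \<Sum>i\<in>I. F i t)"
  using assms
  by (simp add: L2_has_sum_iff_tendsto L2_sum finite_subsets_at_top_finite tendsto_iff eventually_principal)

lemma has_sum_l2inner:
  assumes sum_f: "L2_has_sum F I f" and L2_F: "\<And>i. i \<in> I \<Longrightarrow> L2 (F i)" and L2_h: "L2 h"
  shows "((\<lambda>i. l2inner (F i) h) has_sum l2inner f h) I"
proof -
  have L2_f: "L2 f" and lim: "((\<lambda>G. l2norm (\<lambda>t. f t - (\<Sum>i\<in>G. F i t))) \<longlongrightarrow> 0) (finite_subsets_at_top I)"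
    using sum_f by (simp_all add: L2_has_sum_iff_tendsto)
  have "((\<lambda>G. l2inner f h - (\<Sum>i\<in>G. l2inner (F i) h)) \<longlongrightarrow> 0) (finite_subsets_at_top I)"
  proof (rule Lim_null_comparison[OF eventually_finite_subsets_at_top_weakI
        tendsto_mult_left_zero[OF lim, of "l2norm h"]])
    fix G assume "finite G" "G \<subseteq> I"
    then have F': "L2 (F i)" if "i \<in> G" for i
      using L2_F that by auto
    then show "norm (l2inner f h - (\<Sum>i\<in>G. l2inner (F i) h)) \<le> l2norm (\<lambda>t. f t - (\<Sum>i\<in>G. F i t)) * l2norm h"
      using norm_l2inner_le[OF L2_diff[OF L2_f L2_sum] L2_h, of G F]
      by (simp add: l2inner_diff_left L2_f L2_h L2_sum l2inner_sum_left)
  qed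
  from tendsto_diff[OF tendsto_const[of "l2inner f h"] this] show ?thesis
    by (simp add: has_sum_def)
qed

definition L2_sum_Cauchy :: "('i \<Rightarrow> 'd::finite sig) \<Rightarrow> 'i set \<Rightarrow> bool" where
  "L2_sum_Cauchy F I \<longleftrightarrow> (\<forall>e>0. \<exists>X. finite X \<and> X \<subseteq> I \<and>
     (\<forall>Y. finite Y \<longrightarrow> Y \<subseteq> I \<longrightarrow> X \<inter> Y = {} \<longrightarrow> l2norm (\<lambda>t. \<Sum>i\<in>Y. F i t) < e))"

lemma L2_sum_Cauchy_exhaustion:
  fixes F :: "'i \<Rightarrow> 'd::finite sig"
  assumes Cauchy: "L2_sum_Cauchy F I"
  obtains Z :: "nat \<Rightarrow> 'i set" where "\<And>n. finite (Z n)" "\<And>n. Z n \<subseteq> I" "incseq Z"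
    "\<And>n Y. finite Y \<Longrightarrow> Y \<subseteq> I \<Longrightarrow> Z n \<subseteq> Y \<Longrightarrow>
      l2norm (\<lambda>t. (\<Sum>i\<in>Y. F i t) - (\<Sum>i\<in>Z n. F i t)) < inverse (real (Suc n))"
proof -
  have "\<exists>X. finite X \<and> X \<subseteq> I \<and> (\<forall>Y. finite Y \<longrightarrow> Y \<subseteq> I \<longrightarrow> X \<inter> Y = {} \<longrightarrow>
      l2norm (\<lambda>t. \<Sum>i\<in>Y. F i t) < inverse (real (Suc n)))" for n
    using Cauchy[unfolded L2_sum_Cauchy_def, rule_format, of "inverse (real (Suc n))"] by simp
  then obtain X where X: "\<And>n. finite (X n)" "\<And>n. X n \<subseteq> I"
    and small: "\<And>n Y. finite Y \<Longrightarrow> Y \<subseteq> I \<Longrightarrow> X n \<inter> Y = {} \<Longrightarrow>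
      l2norm (\<lambda>t. \<Sum>i\<in>Y. F i t) < inverse (real (Suc n))"
    by metis
  define Z where "Z n = (\<Union>k\<le>n. X k)" for n
  have Z: "finite (Z n)" "Z n \<subseteq> I" "incseq Z" for n
    using X by (fastforce simp: Z_def incseq_def)+
  have "l2norm (\<lambda>t. (\<Sum>i\<in>Y. F i t) - (\<Sum>i\<in>Z n. F i t)) < inverse (real (Suc n))"
    if "finite Y" "Y \<subseteq> I" "Z n \<subseteq> Y" for Y n
  proof -
    have "(\<lambda>t. (\<Sum>i\<in>Y. F i t) - (\<Sum>i\<in>Z n. F i t)) = (\<lambda>t. \<Sum>i\<in>Y - Z n. F i t)"
      using that by (simp add: fun_eq_iff sum_diff)
    moreover have "l2norm (\<lambda>t. \<Sum>i\<in>Y - Z n. F i t) < inverse (real (Suc n))"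
      using that by (intro small) (auto simp: Z_def)
    ultimately show ?thesis by simp
  qed
  with Z show thesis
    by (rule that)
qed

lemma L2_has_sum_Cauchy:
  fixes F :: "'i \<Rightarrow> 'd::finite sig"
  assumes L2_F: "\<And>i. i \<in> I \<Longrightarrow> L2 (F i)" and Cauchy: "L2_sum_Cauchy F I"
  shows "\<exists>f. L2_has_sum F I f"
proof -
  define T where "T G t = (\<Sum>i\<in>G. F i t)" for G t
  have L2_T: "L2 (T G)" if "G \<subseteq> I" for G
    unfolding T_def[abs_def] using L2_F that by (intro L2_sum) auto
  obtain Z :: "nat \<Rightarrow> 'i set" where Z: "\<And>n. finite (Z n)" "\<And>n. Z n \<subseteq> I" "incseq Z"
    and tail: "\<And>n Y. finite Y \<Longrightarrow> Y \<subseteq> I \<Longrightarrow> Z n \<subseteq> Y \<Longrightarrow>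
      l2norm (\<lambda>t. T Y t - T (Z n) t) < inverse (real (Suc n))"
    unfolding T_def using L2_sum_Cauchy_exhaustion[OF Cauchy] by blast
  have "L2_Cauchy (\<lambda>n. T (Z n))"
    by (rule L2_CauchyI[OF L2_T[OF Z(2)] tail[OF Z(1,2) incseqD[OF Z(3)]]])
  then obtain f where f: "L2 f" "(\<lambda>n. l2norm (\<lambda>t. f t - T (Z n) t)) \<longlonglongrightarrow> 0"
    using L2_complete[of "\<lambda>n. T (Z n)"] L2_T Z(2) by blast
  have "\<forall>\<^sub>F G in finite_subsets_at_top I. l2norm (\<lambda>t. f t - T G t) < e" if "0 < e" for e
  proof -
    have "(\<lambda>n. l2norm (\<lambda>t. f t - T (Z n) t) + inverse (real (Suc n))) \<longlonglongrightarrow> 0"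
      using tendsto_add[OF f(2) LIMSEQ_inverse_real_of_nat] by simp
    from order_tendstoD(2)[OF this \<open>0 < e\<close>]
    obtain n where n: "l2norm (\<lambda>t. f t - T (Z n) t) + inverse (real (Suc n)) < e"
      by (auto simp: eventually_sequentially)
    have "l2norm (\<lambda>t. f t - T G t) < e" if "finite G" "Z n \<subseteq> G" "G \<subseteq> I" for G
      using l2norm_diff_triangle[OF f(1) L2_T[OF Z(2)[of n]] L2_T[OF that(3)]] n tail[OF that(1,3,2)]
        l2norm_diff_commute[of "T (Z n)" "T G"]
      by linarith
    then show ?thesis
      using Z(1,2)[of n] unfolding eventually_finite_subsets_at_top by blast
  qed
  then have "L2_has_sum F I f"
    using f(1) by (simp add: L2_has_sum_iff_tendsto tendsto_iff T_def)
  then show ?thesis by blast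
qed

lemma summable_on_nonneg_small_tail:
  fixes f :: "'i \<Rightarrow> real"
  assumes f_summable: "f summable_on I" and f_nonneg: "\<And>i. i \<in> I \<Longrightarrow> 0 \<le> f i" and "0 < e"
  obtains X where "finite X" "X \<subseteq> I" "\<And>Y. finite Y \<Longrightarrow> Y \<subseteq> I \<Longrightarrow> X \<inter> Y = {} \<Longrightarrow> sum f Y \<le> e"
proof -
  obtain X where X: "finite X" "X \<subseteq> I" "dist (sum f X) (infsum f I) \<le> e"
    using infsum_finite_approximation[OF f_summable \<open>0 < e\<close>] by blast
  show thesis
  proof (rule that[OF X(1,2)])
    fix Y assume Y: "finite Y" "Y \<subseteq> I" "X \<inter> Y = {}"
    have "sum f X + sum f Y = sum f (X \<union> Y)"
      using X(1) Y by (simp add: sum.union_disjoint)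
    also have "\<dots> \<le> infsum f I"
      using X Y f_summable f_nonneg by (intro finite_sum_le_infsum) auto
    finally show "sum f Y \<le> e"
      using X(3) by (simp add: dist_real_def)
  qed
qed

lemma L2_has_sum_Bessel:
  fixes F :: "'i \<Rightarrow> 'd::finite sig"
  assumes L2_F: "\<And>i. i \<in> I \<Longrightarrow> L2 (F i)" and "0 \<le> K"
    and Bessel: "\<And>G. finite G \<Longrightarrow> G \<subseteq> I \<Longrightarrow> (l2norm (\<lambda>t. \<Sum>i\<in>G. c i * F i t))\<^sup>2 \<le> K * (\<Sum>i\<in>G. (cmod (c i))\<^sup>2)"
    and c_summable: "(\<lambda>i. (cmod (c i))\<^sup>2) summable_on I"
  shows "\<exists>f. L2_has_sum (\<lambda>i t. c i * F i t) I f"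
proof (rule L2_has_sum_Cauchy)
  show "L2_sum_Cauchy (\<lambda>i t. c i * F i t) I"
    unfolding L2_sum_Cauchy_def
  proof (intro allI impI)
    fix e :: real assume "0 < e"
    then have tail_pos: "0 < e\<^sup>2 / (K + 1)"
      using \<open>0 \<le> K\<close> by simp
    obtain X where X: "finite X" "X \<subseteq> I"
      and small: "\<And>Y. finite Y \<Longrightarrow> Y \<subseteq> I \<Longrightarrow> X \<inter> Y = {} \<Longrightarrow> (\<Sum>i\<in>Y. (cmod (c i))\<^sup>2) \<le> e\<^sup>2 / (K + 1)"
      by (rule summable_on_nonneg_small_tail[OF c_summable _ tail_pos]) auto
    have "l2norm (\<lambda>t. \<Sum>i\<in>Y. c i * F i t) < e" if Y: "finite Y" "Y \<subseteq> I" "X \<inter> Y = {}" for Y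
    proof (rule power2_less_imp_less)
      have "(l2norm (\<lambda>t. \<Sum>i\<in>Y. c i * F i t))\<^sup>2 \<le> K * (\<Sum>i\<in>Y. (cmod (c i))\<^sup>2)"
        by (rule Bessel[OF Y(1,2)])
      also have "\<dots> \<le> K * (e\<^sup>2 / (K + 1))"
        by (rule mult_left_mono[OF small[OF Y] \<open>0 \<le> K\<close>])
      also have "\<dots> < e\<^sup>2"
        using \<open>0 < e\<close> \<open>0 \<le> K\<close> by (simp add: field_simps)
      finally show "(l2norm (\<lambda>t. \<Sum>i\<in>Y. c i * F i t))\<^sup>2 < e\<^sup>2" .
    qed (use \<open>0 < e\<close> in simp)
    with X show "\<exists>X. finite X \<and> X \<subseteq> I \<and> (\<forall>Y. finite Y \<longrightarrow> Y \<subseteq> I \<longrightarrow> X \<inter> Y = {} \<longrightarrow>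
        l2norm (\<lambda>t. \<Sum>i\<in>Y. c i * F i t) < e)"
      by blast
  qed
qed (intro L2_cmult L2_F)

section \<open>Time-frequency shifts and the symplectic form\<close>

definition symplectic_form :: "real ^ ('d::finite + 'd) \<Rightarrow> real ^ ('d + 'd) \<Rightarrow> real" where
  "symplectic_form u z = freq u \<bullet> pos z - pos u \<bullet> freq z"

lemma symplectic_form_eq_Jmat: "symplectic_form u z = u \<bullet> (Jmat *v z)"
proof -
  have sum_Plus: "(\<Sum>i\<in>UNIV. h i) = (\<Sum>k\<in>UNIV. h (Inl k)) + (\<Sum>k\<in>UNIV. h (Inr k))" for h :: "'a + 'a \<Rightarrow> real"
    by (simp add: UNIV_Plus_UNIV[symmetric] sum.Plus del: UNIV_Plus_UNIV)
  have "(Jmat *v z) $ Inl k = - z $ Inr k" "(Jmat *v z) $ Inr k = z $ Inl k" for k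
    by (simp_all add: matrix_vector_mult_def sum_Plus Jmat_def if_distrib[of "\<lambda>x. x * _"] cong: if_cong)
  then show ?thesis
    by (simp add: symplectic_form_def inner_vec_def sum_Plus pos_def freq_def sum_negf)
qed

lemma symplectic_form_invariant:
  assumes "symplectic S"
  shows "symplectic_form (S *v u) (S *v z) = symplectic_form u z"
proof -
  have adjoint: "(S *v u) \<bullet> w = u \<bullet> (transpose S *v w)" for w
    by (simp add: dot_lmul_matrix inner_commute[of u] inner_commute[of _ w])
  have "(S *v u) \<bullet> (Jmat *v (S *v z)) = u \<bullet> ((transpose S ** Jmat ** S) *v z)"
    by (simp only: adjoint matrix_vector_mul_assoc matrix_mul_assoc)
  then show ?thesis
    using assms by (simp add: symplectic_form_eq_Jmat symplectic_def)
qed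

lemma pos_pair_vec [simp]: "pos (pair_vec x \<omega>) = x"
  and freq_pair_vec [simp]: "freq (pair_vec x \<omega>) = \<omega>"
  by (simp_all add: pos_def freq_def pair_vec_def)

lemma tfshift_eq_cis2pi:
  "tfshift z h t = cis2pi (freq z \<bullet> t - pos z \<bullet> freq z / 2) * h (t - pos z)"
proof -
  have "cis2pi (freq z \<bullet> t - pos z \<bullet> freq z / 2) = cis2pi (- (pos z \<bullet> freq z) / 2) * cis2pi (freq z \<bullet> t)"
    by (simp flip: cis2pi_add)
  then show ?thesis
    by (simp add: tfshift_def exp_eq_cis2pi)
qed

lemma tfshift_pair_vec_0: "tfshift (pair_vec m 0) h = transl m h"
  by (simp add: tfshift_def transl_def)

lemma L2_tfshift: "L2 h \<Longrightarrow> L2 (tfshift z h)"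
  unfolding tfshift_eq_cis2pi[abs_def]
  by (rule L2_bounded_mult[where K = 1, OF L2_transl[of h "pos z", unfolded transl_def]]) auto

lemma tfshift_cong_AE:
  assumes "L2 f" "L2 h" "AE t in lborel. f t = h t"
  shows "AE t in lborel. tfshift z f t = tfshift z h t"
proof -
  note [measurable] = assms(1,2)[THEN L2_measurable]
  have "AE t in lborel. f (t - pos z) = h (t - pos z)"
    by (rule AE_lborel_shift[OF assms(3)]) measurable
  then show ?thesis
    by eventually_elim (simp add: tfshift_def)
qed

lemma stft_eq_l2inner: "stft g f z = cis2pi (- (pos z \<bullet> freq z) / 2) * l2inner f (tfshift z g)"
proof -
  have "f t * cnj (g (t - pos z)) * cis2pi (- (freq z \<bullet> t))
      = cis2pi (- (pos z \<bullet> freq z) / 2) * (f t * cnj (tfshift z g t))" for t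
  proof -
    have "cis2pi (- (freq z \<bullet> t))
        = cis2pi (- (pos z \<bullet> freq z) / 2) * cis2pi (- (freq z \<bullet> t - pos z \<bullet> freq z / 2))"
      by (simp flip: cis2pi_add)
    then show ?thesis
      by (simp add: tfshift_eq_cis2pi)
  qed
  then show ?thesis
    by (simp only: stft_def l2inner_def exp_eq_cis2pi integral_mult_right_zero)
qed

lemma cmod_stft: "cmod (stft g f z) = cmod (l2inner f (tfshift z g))"
  by (simp add: stft_eq_l2inner norm_mult)

lemma l2inner_tfshift_reflect:
  fixes g :: "'d::finite sig"
  assumes L2_g: "L2 g"
  shows "l2inner (tfshift u (reflect g)) (tfshift z g)
    = cis2pi (symplectic_form u z) * cnj (l2inner (tfshift u (reflect g)) (tfshift z g))"
proof -
  define p where "p t = (freq u \<bullet> t - pos u \<bullet> freq u / 2) - (freq z \<bullet> t - pos z \<bullet> freq z / 2)" for t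
  define q where "q t = tfshift u (reflect g) t * cnj (tfshift z g t)" for t
  have q_eq: "q t = cis2pi (p t) * (g (pos u - t) * cnj (g (t - pos z)))" for t
    unfolding q_def p_def tfshift_eq_cis2pi reflect_def diff_conv_add_uminus[of "_ - _ / 2"] cis2pi_add by simp
  have hermitian: "q (pos u + pos z - t) = cis2pi (symplectic_form u z) * cnj (q t)" for t
  proof -
    have "p (pos u + pos z - t) = symplectic_form u z - p t"
      by (simp add: p_def symplectic_form_def algebra_simps inner_commute)
    then have "cis2pi (p (pos u + pos z - t)) = cis2pi (symplectic_form u z) * cis2pi (- p t)"
      by (simp flip: cis2pi_add)
    then show ?thesis
      by (simp add: q_eq)
  qed
  have "(LINT t|lborel. q t) = (LINT t|lborel. q (pos u + pos z - t))"
    using L2_l2inner_integrable[OF L2_tfshift[OF L2_reflect[OF L2_g]] L2_tfshift[OF L2_g]]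
    by (intro lborel_integral_reflect_shift[symmetric]) (auto simp: q_def[abs_def])
  also have "\<dots> = cis2pi (symplectic_form u z) * cnj (LINT t|lborel. q t)"
    by (simp only: hermitian integral_mult_right_zero Bochner_Integration.integral_cnj)
  finally show ?thesis
    by (simp only: l2inner_def q_def)
qed

section \<open>Metaplectic translates\<close>

lemma unitary_pair_sum:
  assumes unitary: "unitary_pair U V" and "finite G" and L2_F: "\<And>i. L2 (F i)"
  shows "AE t in lborel. U (\<lambda>s. \<Sum>i\<in>G. c i * F i s) t = (\<Sum>i\<in>G. c i * U (F i) t)"
proof -
  have linear: "AE t in lborel. U (\<lambda>s. f s + a * h s) t = U f t + a * U h t" if "L2 f" "L2 h" for f h a
    using unitary that unfolding unitary_pair_def by simp
  show ?thesis
    using \<open>finite G\<close>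
  proof (induction G)
    case empty
    have "AE t in lborel. U (\<lambda>s. 0 + 1 * 0) t = U (\<lambda>s. 0) t + 1 * U (\<lambda>s. 0) t"
      by (rule linear) simp_all
    then show ?case by simp
  next
    case (insert i G)
    have "AE t in lborel. U (\<lambda>s. (\<Sum>i\<in>G. c i * F i s) + c i * F i s) t
        = U (\<lambda>s. \<Sum>i\<in>G. c i * F i s) t + c i * U (F i) t"
      by (intro linear L2_sum L2_cmult L2_F)
    with insert.IH show ?case
      by eventually_elim (simp add: insert.hyps add.commute)
  qed
qed

lemma unitary_pair_l2norm:
  assumes "unitary_pair U V" "L2 f"
  shows "l2norm (U f) = l2norm f"
  using assms by (auto simp: unitary_pair_def l2dist_eq_l2norm)

lemma l2norm_sum_transl_S:
  assumes unitary: "unitary_pair U V" and L2_h: "L2 h" and "finite G"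
  shows "l2norm (\<lambda>t. \<Sum>m\<in>G. c m * transl_S U V m h t) = l2norm (\<lambda>t. \<Sum>m\<in>G. c m * transl m (V h) t)"
proof -
  have L2_Vh: "L2 (V h)" and L2_U: "\<And>f. L2 f \<Longrightarrow> L2 (U f)"
    using unitary L2_h by (auto simp: unitary_pair_def)
  have "AE t in lborel. U (\<lambda>s. \<Sum>m\<in>G. c m * transl m (V h) s) t = (\<Sum>m\<in>G. c m * transl_S U V m h t)"
    unfolding transl_S_def by (intro unitary_pair_sum[OF unitary \<open>finite G\<close>] L2_transl L2_Vh)
  then have "l2norm (U (\<lambda>s. \<Sum>m\<in>G. c m * transl m (V h) s)) = l2norm (\<lambda>t. \<Sum>m\<in>G. c m * transl_S U V m h t)"
    unfolding transl_S_def by (intro l2norm_cong_AE L2_sum L2_cmult L2_U L2_transl L2_Vh)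
  then show ?thesis
    by (simp add: unitary_pair_l2norm[OF unitary L2_translates[OF L2_Vh]])
qed

lemma
  assumes metaplectic: "metaplectic_pair S U V" and L2_h: "L2 h"
  shows L2_transl_S: "L2 (transl_S U V m h)"
    and AE_transl_S_eq_tfshift: "AE t in lborel. transl_S U V m h t = tfshift (S *v pair_vec m 0) h t"
proof -
  have unitary: "unitary_pair U V"
    and covariance: "\<And>z f. L2 f \<Longrightarrow> AE t in lborel. U (tfshift z f) t = tfshift (S *v z) (U f) t"
    using metaplectic by (auto simp: metaplectic_pair_def)
  have L2_Vh: "L2 (V h)" and L2_U: "\<And>f. L2 f \<Longrightarrow> L2 (U f)" and UV_h: "AE t in lborel. U (V h) t = h t"
    using unitary L2_h by (auto simp: unitary_pair_def)
  show "L2 (transl_S U V m h)"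
    unfolding transl_S_def by (intro L2_U L2_transl L2_Vh)
  have "AE t in lborel. U (transl m (V h)) t = tfshift (S *v pair_vec m 0) (U (V h)) t"
    using covariance[OF L2_Vh, of "pair_vec m 0"] by (simp add: tfshift_pair_vec_0)
  moreover have "AE t in lborel. tfshift (S *v pair_vec m 0) (U (V h)) t = tfshift (S *v pair_vec m 0) h t"
    by (intro tfshift_cong_AE L2_U L2_Vh L2_h UV_h)
  ultimately show "AE t in lborel. transl_S U V m h t = tfshift (S *v pair_vec m 0) h t"
    unfolding transl_S_def by eventually_elim simp
qed

lemma l2inner_transl_S_reflect_real:
  fixes g :: "'d::finite sig"
  assumes L2_g: "L2 g" and inv_A: "invertible A" and symplectic: "symplectic S"
    and metaplectic: "metaplectic_pair S U V"
    and m_lattice: "m \<in> lattice A" and l_dual: "l \<in> dual_lattice A"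
  shows "l2inner (transl_S U V m (reflect g)) (tfshift (S *v pair_vec x l) g) \<in> \<real>"
proof -
  let ?u = "S *v pair_vec m 0" and ?z = "S *v pair_vec x l"
  have "l2inner (transl_S U V m (reflect g)) (tfshift ?z g) = l2inner (tfshift ?u (reflect g)) (tfshift ?z g)"
    by (intro l2inner_cong_AE L2_transl_S[OF metaplectic] AE_transl_S_eq_tfshift[OF metaplectic]
        L2_tfshift L2_reflect L2_g)
  moreover have "symplectic_form ?u ?z = - (m \<bullet> l)"
    unfolding symplectic_form_invariant[OF symplectic] by (simp add: symplectic_form_def)
  then have "cis2pi (symplectic_form ?u ?z) = 1"
    using inner_lattice_dual_lattice[OF inv_A m_lattice l_dual] by (simp add: cis2pi_Ints)
  ultimately show ?thesis
    using l2inner_tfshift_reflect[OF L2_g, of ?u ?z] by (simp add: Reals_cnj_iff)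
qed

lemma cmod_stft_cnj_coefficients:
  fixes g :: "'d::finite sig"
  assumes L2_g: "L2 g" and inv_A: "invertible A" and symplectic: "symplectic S"
    and metaplectic: "metaplectic_pair S U V"
    and I_lattice: "I \<subseteq> lattice A" and l_dual: "l \<in> dual_lattice A"
    and sum_f: "L2_has_sum (\<lambda>m t. c m * transl_S U V m (reflect g) t) I f"
    and sum_fx: "L2_has_sum (\<lambda>m t. cnj (c m) * transl_S U V m (reflect g) t) I fx"
  shows "cmod (stft g f (S *v pair_vec x l)) = cmod (stft g fx (S *v pair_vec x l))"
proof -
  define h where "h = tfshift (S *v pair_vec x l) g"
  define a where "a m = l2inner (transl_S U V m (reflect g)) h" for m
  have L2_h: "L2 h"
    unfolding h_def by (rule L2_tfshift[OF L2_g])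
  have has_sum_coeff: "((\<lambda>m. b m * a m) has_sum l2inner k h) I"
    if "L2_has_sum (\<lambda>m t. b m * transl_S U V m (reflect g) t) I k" for b k
    using has_sum_l2inner[OF that L2_cmult[OF L2_transl_S[OF metaplectic L2_reflect[OF L2_g]]] L2_h]
    by (simp add: l2inner_cmult_left a_def)
  have "a m \<in> \<real>" if "m \<in> I" for m
    unfolding a_def h_def using I_lattice that
    by (intro l2inner_transl_S_reflect_real[OF L2_g inv_A symplectic metaplectic _ l_dual]) auto
  then have "((\<lambda>m. cnj (c m) * a m) has_sum l2inner fx h) I \<longleftrightarrow> ((\<lambda>m. cnj (c m * a m)) has_sum l2inner fx h) I"
    by (intro has_sum_cong) (simp add: Reals_cnj_iff)
  then have "((\<lambda>m. cnj (c m * a m)) has_sum l2inner fx h) I"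
    using has_sum_coeff[OF sum_fx] by blast
  moreover have "((\<lambda>m. cnj (c m * a m)) has_sum cnj (l2inner f h)) I"
    using has_sum_coeff[OF sum_f] by (simp only: has_sum_cnj_iff)
  ultimately have "l2inner fx h = cnj (l2inner f h)"
    by (rule has_sum_unique)
  then show ?thesis
    by (simp add: cmod_stft h_def)
qed

lemma L2_has_sum_transl_S:
  fixes h :: "'d::finite sig"
  assumes inv_A: "invertible A" and metaplectic: "metaplectic_pair S U V" and L2_h: "L2 h"
    and fourier_H: "is_L2_fourier (V h) H"
    and bound: "AE t in lborel. t \<in> dual_cell A \<longrightarrow> periodization (dual_lattice A) H t \<le> ennreal C"
    and c_summable: "(\<lambda>m. (cmod (c m))\<^sup>2) summable_on lattice A"
  shows "\<exists>f. L2_has_sum (\<lambda>m t. c m * transl_S U V m h t) (lattice A) f"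
proof (rule L2_has_sum_Bessel)
  let ?D = "half_open_dual_cell A"
  show "L2 (transl_S U V m h)" for m
    by (rule L2_transl_S[OF metaplectic L2_h])
  show "0 \<le> max 0 C * measure lborel ?D"
    by simp
  have unitary: "unitary_pair U V"
    using metaplectic by (simp add: metaplectic_pair_def)
  have L2_Vh: "L2 (V h)"
    using unitary L2_h by (auto simp: unitary_pair_def)
  have cell_bound: "AE t in lborel. t \<in> ?D \<longrightarrow> periodization (dual_lattice A) H t \<le> ennreal (max 0 C)"
    using bound
  proof eventually_elim
    case (elim t)
    then show ?case
      using half_open_dual_cell_subset[OF inv_A] by (auto intro: order_trans[OF _ ennreal_leI])
  qed
  show "(l2norm (\<lambda>t. \<Sum>m\<in>G. c m * transl_S U V m h t))\<^sup>2
      \<le> max 0 C * measure lborel ?D * (\<Sum>m\<in>G. (cmod (c m))\<^sup>2)" if G: "finite G" "G \<subseteq> lattice A" for G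
    unfolding l2norm_sum_transl_S[OF unitary L2_h G(1)] using G(2) inner_lattice_dual_lattice[OF inv_A]
    by (intro Bessel_translates[OF fundamental_domain_dual_lattice[OF inv_A] L2_Vh fourier_H _ cell_bound G(1)])
      auto
qed (rule c_summable)

theorem theorem3p1:
  fixes g :: "'d::finite sig"
    and A :: "real ^ 'd ^ 'd"
    and S :: "real ^ ('d + 'd) ^ ('d + 'd)"
    and U V :: "'d sig \<Rightarrow> 'd sig"
    and c :: "'d rvec \<Rightarrow> complex"
  assumes g: "L2 g"
    and A: "invertible A"
    and S: "symplectic S"
    and mu: "metaplectic_pair S U V"
  shows
    "(finite {m\<in>lattice A. c m \<noteq> 0} \<longrightarrow>
       (\<forall>x l. l \<in> dual_lattice A \<longrightarrow>
          cmod (stft g (\<lambda>t. \<Sum>m\<in>{m\<in>lattice A. c m \<noteq> 0}.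
                              c m * transl_S U V m (reflect g) t) (S *v pair_vec x l))
        = cmod (stft g (\<lambda>t. \<Sum>m\<in>{m\<in>lattice A. c m \<noteq> 0}.
                              cnj (c m) * transl_S U V m (reflect g) t) (S *v pair_vec x l))))
     \<and>
     ((\<exists>H C. is_L2_fourier (V (reflect g)) H \<and>
             (AE t in lborel. t \<in> dual_cell A \<longrightarrow>
                 periodization (dual_lattice A) H t \<le> ennreal C))
      \<and> (\<lambda>m. (cmod (c m))^2) summable_on lattice A
      \<longrightarrow>
       (\<exists>f. L2_has_sum (\<lambda>m. \<lambda>t. c m * transl_S U V m (reflect g) t) (lattice A) f) \<and>
       (\<exists>fx. L2_has_sum (\<lambda>m. \<lambda>t. cnj (c m) * transl_S U V m (reflect g) t) (lattice A) fx) \<and>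
       (\<forall>f fx. L2_has_sum (\<lambda>m. \<lambda>t. c m * transl_S U V m (reflect g) t) (lattice A) f \<longrightarrow>
               L2_has_sum (\<lambda>m. \<lambda>t. cnj (c m) * transl_S U V m (reflect g) t) (lattice A) fx \<longrightarrow>
          (\<forall>x l. l \<in> dual_lattice A \<longrightarrow>
             cmod (stft g f (S *v pair_vec x l)) = cmod (stft g fx (S *v pair_vec x l)))))"
proof (intro conjI impI allI)
  let ?I = "{m\<in>lattice A. c m \<noteq> 0}"
  fix x l :: "'d rvec" assume "finite ?I" and l: "l \<in> dual_lattice A"
  then show "cmod (stft g (\<lambda>t. \<Sum>m\<in>?I. c m * transl_S U V m (reflect g) t) (S *v pair_vec x l))
      = cmod (stft g (\<lambda>t. \<Sum>m\<in>?I. cnj (c m) * transl_S U V m (reflect g) t) (S *v pair_vec x l))"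
    by (intro cmod_stft_cnj_coefficients[where I = ?I and c = c, OF g A S mu _ l] L2_has_sum_finite
        L2_cmult L2_transl_S[OF mu L2_reflect[OF g]]) auto
next
  assume "(\<exists>H C. is_L2_fourier (V (reflect g)) H \<and>
      (AE t in lborel. t \<in> dual_cell A \<longrightarrow> periodization (dual_lattice A) H t \<le> ennreal C))
    \<and> (\<lambda>m. (cmod (c m))^2) summable_on lattice A"
  then show "\<exists>f. L2_has_sum (\<lambda>m t. c m * transl_S U V m (reflect g) t) (lattice A) f"
    and "\<exists>fx. L2_has_sum (\<lambda>m t. cnj (c m) * transl_S U V m (reflect g) t) (lattice A) fx"
    using L2_has_sum_transl_S[OF A mu L2_reflect[OF g]] by auto
qed (rule cmod_stft_cnj_coefficients[OF g A S mu order_refl])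

end
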